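(* Let $(A,\cdot_A,\mathfrak B,P)$ be a quadratic Rota-Baxter perm algebra of weight $0$. Let $r\in A\otimes A$ be the 2-tensor determined by $$T_r(a^* )=P((\mathfrak B^\sharp)^{-1}(a^* )),\quad\forall a^*\in A^*.$$ Then $(A,\cdot_A,\Delta_r)$ is a triangular perm bialgebra, where $\Delta_r(a)=(\mathrm{id}\otimes R(a)-\mathrm{ad}(a)\otimes\mathrm{id})(r)$ for all $a\in A$.
   Context: Conventions: the base field $\mathbb K$ has characteristic zero; all vector spaces and algebras are finite-dimensional. For a bilinear operation $\cdot_A$ on $A$: $L(a)b=a\cdot_A b$, $R(a)b=b\cdot_A a$, $\mathrm{ad}(a)=L(a)-R(a)$. $\sigma(u\otimes v)=v\otimes u$. Perm algebra: a vector space $A$ with bilinear $\cdot_A$ such that $a\cdot_A(b\cdot_A c)=(a\cdot_A b)\cdot_A c=(b\cdot_A a)\cdot_A c$ for all $a,b,c\in A$. Perm coalgebra: $(A,\Delta)$ with $\Delta:A\to A\otimes A$ linear and $(\Delta\otimes\mathrm{id})\Delta=(\mathrm{id}\otimes\Delta)\Delta=(\sigma\otimes\mathrm{id})(\Delta\otimes\mathrm{id})\Delta$. Perm bialgebra: $(A,\cdot_A,\Delta)$ with $(A,\cdot_A)$ a perm algebra, $(A,\Delta)$ a perm coalgebra, and for all $a,b\in A$: $\Delta(a\cdot_A b)=(\mathrm{ad}(a)\otimes\mathrm{id})\Delta(b)+(\mathrm{id}\otimes R(b))\Delta(a)$; $\sigma(R(b)\otimes\mathrm{id})\Delta(a)=(R(a)\otimes\mathrm{id})\Delta(b)$;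 $\Delta(a\cdot_A b)=(\mathrm{id}\otimes L(a))\Delta(b)+(\mathrm{ad}(b)\otimes\mathrm{id})(\Delta(a)-\sigma\Delta(a))$. For $r=\sum_i a_i\otimes b_i\in A\otimes A$: $T_r:A^*\to A$, $T_r(a^* )=\sum_i\langle a^*,a_i\rangle b_i$ (this identifies $A\otimes A$ with $\mathrm{Hom}(A^*,A)$). $r$ is a solution of the perm Yang-Baxter equation in $(A,\cdot_A)$ if $\sum_{i,j}\big(a_i\otimes b_i\cdot_A a_j\otimes b_j-a_i\otimes a_j\otimes b_i\cdot_A b_j+a_i\cdot_A a_j\otimes b_i\otimes b_j-a_j\cdot_A a_i\otimes b_i\otimes b_j\big)=0$. $s\in A\otimes A$ is $(R,\mathrm{ad})$-invariant if $(\mathrm{id}\otimes R(a)-\mathrm{ad}(a)\otimes\mathrm{id})(s)=0$ for all $a\in A$. Quasi-triangular perm bialgebra: a perm bialgebra $(A,\cdot_A,\Delta_r)$ where $r$ solves the perm Yang-Baxter equation and $\frac12(r-\sigma(r))$ is $(R,\mathrm{ad})$-invariant. It is called triangular if $r$ is symmetric ($\sigma(r)=r$). A bilinear form $\mathfrak B$ on a perm algebra is invariant if $\mathfrak B(a\cdot_A b,c)=\mathfrak B(a,b\cdot_A c-c\cdot_A b)$. A quadratic perm algebra $(A,\cdot_A,\mathfrak B)$ is a perm algebra with a nondegenerate skew-symmetric invariant bilinear form; $\mathfrak B^\sharp:A\to A^*$ is $\langle\mathfrak B^\sharp(a),b\rangle=\mathfrak B(a,b)$. A Rota-Baxter operator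 of weight $\lambda$ on $(A,\cdot_A)$ is a linear map $P:A\to A$ with $P(a)\cdot_A P(b)=P(P(a)\cdot_A b+a\cdot_A P(b)+\lambda a\cdot_A b)$. A quadratic Rota-Baxter perm algebra of weight $\lambda$ is $(A,\cdot_A,\mathfrak B,P)$ with $(A,\cdot_A,\mathfrak B)$ a quadratic perm algebra and $P$ a Rota-Baxter operator of weight $\lambda$ such that $\mathfrak B(P(a),b)+\mathfrak B(a,P(b))+\lambda\mathfrak B(a,b)=0$ for all $a,b\in A$. *)

theory Defs
  imports Complex_Main "HOL-Library.Function_Algebras"
begin

section \<open>Multilinear maps\<close>

definition bilinear_map ::
  "('k::field \<Rightarrow> 'a::ab_group_add \<Rightarrow> 'a) \<Rightarrow> ('k \<Rightarrow> 'b::ab_group_add \<Rightarrow> 'b) \<Rightarrow>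
   ('k \<Rightarrow> 'c::ab_group_add \<Rightarrow> 'c) \<Rightarrow> ('a \<Rightarrow> 'b \<Rightarrow> 'c) \<Rightarrow> bool"
  where "bilinear_map s1 s2 s3 h \<longleftrightarrow>
    (\<forall>x. Vector_Spaces.linear s2 s3 (\<lambda>y. h x y)) \<and>
    (\<forall>y. Vector_Spaces.linear s1 s3 (\<lambda>x. h x y))"

definition trilinear_form ::
  "('k::field \<Rightarrow> 'a::ab_group_add \<Rightarrow> 'a) \<Rightarrow> ('a \<Rightarrow> 'a \<Rightarrow> 'a \<Rightarrow> 'k) \<Rightarrow> bool"
  where "trilinear_form s h \<longleftrightarrow>
    (\<forall>y z. Vector_Spaces.linear s (*) (\<lambda>x. h x y z)) \<and>
    (\<forall>x z. Vector_Spaces.linear s (*) (\<lambda>y. h x y z)) \<and>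
    (\<forall>x y. Vector_Spaces.linear s (*) (\<lambda>z. h x y z))"


section \<open>Tensor powers of a finite-dimensional vector space\<close>

text \<open>
  The pure tensor \<open>a \<otimes> b\<close> is represented by the evaluation functional \<open>\<beta> \<mapsto> \<beta> a b\<close>
  on the bilinear forms \<open>\<beta>\<close> on \<open>A\<close>, and \<open>A \<otimes> A\<close> is the set of finite sums of pure tensors. Hence
  two finite sums of pure tensors are equal iff every bilinear form takes the same value on them;
  as linear functionals separate the points of a vector space, this is the tensor product
  (lemma \<open>lift_tensor_sum\<close> below is its universal property). The third tensor power is
  built likewise from trilinear forms.
\<close>

type_synonym ('a, 'k) tensor2 = "('a \<Rightarrow> 'a \<Rightarrow> 'k) \<Rightarrow> 'k"
type_synonym ('a, 'k) tensor3 = "('a \<Rightarrow> 'a \<Rightarrow> 'a \<Rightarrow> 'k) \<Rightarrow> 'k"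

definition tscale :: "'k::field \<Rightarrow> ('f \<Rightarrow> 'k) \<Rightarrow> ('f \<Rightarrow> 'k)"
  where "tscale c t = (\<lambda>\<beta>. c * t \<beta>)"

lemma vector_space_mult: "vector_space ((*) :: 'k::field \<Rightarrow> 'k \<Rightarrow> 'k)"
  by unfold_locales (auto simp: algebra_simps)

lemma vector_space_tscale: "vector_space (tscale :: 'k::field \<Rightarrow> ('f \<Rightarrow> 'k) \<Rightarrow> ('f \<Rightarrow> 'k))"
  by unfold_locales (auto simp: tscale_def fun_eq_iff algebra_simps)

lemma linear_sum_list:
  assumes "Vector_Spaces.linear s1 s2 f"
  shows "f (\<Sum>x\<leftarrow>xs. g x) = (\<Sum>x\<leftarrow>xs. f (g x))"
proof -
  interpret Vector_Spaces.linear s1 s2 f by fact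
  show ?thesis by (induction xs) (auto simp: add zero)
qed

lemma linear_map_diff:
  assumes "Vector_Spaces.linear s1 s2 f"
  shows "f (x - y) = f x - f y"
proof -
  interpret Vector_Spaces.linear s1 s2 f by fact
  show ?thesis by (rule diff)
qed

lemma separating_functional:
  fixes s :: "'k::field \<Rightarrow> 'w::ab_group_add \<Rightarrow> 'w"
  assumes "vector_space s" "w \<noteq> 0"
  shows "\<exists>\<phi>. Vector_Spaces.linear s (*) \<phi> \<and> \<phi> w \<noteq> 0"
proof -
  interpret vector_space_pair s "(*) :: 'k \<Rightarrow> 'k \<Rightarrow> 'k"
    using assms(1) vector_space_mult by (rule vector_space_pair.intro)
  have "vs1.independent {w}" using assms(2) by simp
  from linear_independent_extend[OF this, of "\<lambda>_. 1"] show ?thesis by force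
qed

lemma linear_compose_left:
  assumes "Vector_Spaces.linear s1 s2 f" "Vector_Spaces.linear s2 s3 g"
  shows "Vector_Spaces.linear s1 s3 (\<lambda>x. g (f x))"
  using Vector_Spaces.linear_compose[OF assms] by (simp add: o_def)

lemma bilinear_mapI:
  assumes "vector_space s1" "vector_space s2" "vector_space s3"
    and "\<And>x y z. h (x + y) z = h x z + h y z" "\<And>x y z. h z (x + y) = h z x + h z y"
    and "\<And>c x z. h (s1 c x) z = s3 c (h x z)" "\<And>c x z. h z (s2 c x) = s3 c (h z x)"
  shows "bilinear_map s1 s2 s3 h"
  unfolding bilinear_map_def Vector_Spaces.linear_iff by (intro conjI allI; rule assms)

lemma bilinear_mapD:
  assumes "bilinear_map s1 s2 s3 h"
  shows "vector_space s1" "vector_space s2" "vector_space s3"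
    and "h (x + y) z = h x z + h y z" "h w (u + v) = h w u + h w v"
    and "h (s1 c x) z = s3 c (h x z)" "h w (s2 c u) = s3 c (h w u)"
  using assms unfolding bilinear_map_def Vector_Spaces.linear_iff by blast+

locale fd_space = vector_space scale
  for scale :: "'k::field_char_0 \<Rightarrow> 'a::ab_group_add \<Rightarrow> 'a" (infixr "*s" 75) +
  assumes finite_dim: "\<exists>B. finite B \<and> span B = UNIV"
begin

definition dual :: "('a \<Rightarrow> 'k) set"
  where "dual = {\<phi>. Vector_Spaces.linear scale (*) \<phi>}"

definition tensor :: "'a \<Rightarrow> 'a \<Rightarrow> ('a, 'k) tensor2" (infix "\<otimes>" 72)
  where "a \<otimes> b = (\<lambda>\<beta>. if bilinear_map scale scale (*) \<beta> then \<beta> a b else 0)"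

definition tensor3 :: "'a \<Rightarrow> 'a \<Rightarrow> 'a \<Rightarrow> ('a, 'k) tensor3" (\<open>_ \<otimes>\<^sub>3 _ \<otimes>\<^sub>3 _\<close> [73, 73, 73] 72)
  where "a \<otimes>\<^sub>3 b \<otimes>\<^sub>3 c = (\<lambda>\<tau>. if trilinear_form scale \<tau> then \<tau> a b c else 0)"

definition tensors :: "('a, 'k) tensor2 set"
  where "tensors = {t. \<exists>xs. t = (\<Sum>(a, b)\<leftarrow>xs. a \<otimes> b)}"

text \<open>
  The linear map induced by a bilinear map \<open>h\<close>, sending \<open>\<Sum> a\<^sub>i \<otimes> b\<^sub>i\<close> to
  \<open>\<Sum> h a\<^sub>i b\<^sub>i\<close>. It is only meaningful for bilinear \<open>h\<close> and on elements of \<open>A \<otimes> A\<close>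
  (elsewhere the value is arbitrary).
\<close>

definition lift_tensor :: "('a \<Rightarrow> 'a \<Rightarrow> 'w::ab_group_add) \<Rightarrow> ('a, 'k) tensor2 \<Rightarrow> 'w"
  where "lift_tensor h t =
    (THE w. \<exists>xs. t = (\<Sum>(a, b)\<leftarrow>xs. a \<otimes> b) \<and> w = (\<Sum>(a, b)\<leftarrow>xs. h a b))"

definition lift_tensor3 :: "('a \<Rightarrow> 'a \<Rightarrow> 'a \<Rightarrow> 'w::ab_group_add) \<Rightarrow> ('a, 'k) tensor3 \<Rightarrow> 'w"
  where "lift_tensor3 h t =
    (THE w. \<exists>xs. t = (\<Sum>(a, b, c)\<leftarrow>xs. a \<otimes>\<^sub>3 b \<otimes>\<^sub>3 c) \<and> w = (\<Sum>(a, b, c)\<leftarrow>xs. h a b c))"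

text \<open>\<open>f \<otimes> g\<close> on \<open>A \<otimes> A\<close>, the flip \<open>\<sigma>\<close>, and \<open>\<sigma> \<otimes> id\<close> on the third tensor power.\<close>

definition tensor_map :: "('a \<Rightarrow> 'a) \<Rightarrow> ('a \<Rightarrow> 'a) \<Rightarrow> ('a, 'k) tensor2 \<Rightarrow> ('a, 'k) tensor2"
  where "tensor_map f g = lift_tensor (\<lambda>x y. f x \<otimes> g y)"

definition flip :: "('a, 'k) tensor2 \<Rightarrow> ('a, 'k) tensor2"
  where "flip = lift_tensor (\<lambda>x y. y \<otimes> x)"

definition flip12 :: "('a, 'k) tensor3 \<Rightarrow> ('a, 'k) tensor3"
  where "flip12 = lift_tensor3 (\<lambda>x y z. y \<otimes>\<^sub>3 x \<otimes>\<^sub>3 z)"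

text \<open>\<open>\<Delta> \<otimes> id\<close> and \<open>id \<otimes> \<Delta>\<close> for a linear map \<open>\<Delta>: A \<rightarrow> A \<otimes> A\<close>.\<close>

definition coprod_left :: "('a \<Rightarrow> ('a, 'k) tensor2) \<Rightarrow> ('a, 'k) tensor2 \<Rightarrow> ('a, 'k) tensor3"
  where "coprod_left \<Delta> = lift_tensor (\<lambda>x y. lift_tensor (\<lambda>u v. u \<otimes>\<^sub>3 v \<otimes>\<^sub>3 y) (\<Delta> x))"

definition coprod_right :: "('a \<Rightarrow> ('a, 'k) tensor2) \<Rightarrow> ('a, 'k) tensor2 \<Rightarrow> ('a, 'k) tensor3"
  where "coprod_right \<Delta> = lift_tensor (\<lambda>x y. lift_tensor (\<lambda>u v. x \<otimes>\<^sub>3 u \<otimes>\<^sub>3 v) (\<Delta> y))"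

text \<open>\<open>T\<^sub>r(a\<^sup>*) = \<Sum> \<langle>a\<^sup>*, a\<^sub>i\<rangle> b\<^sub>i\<close> for \<open>r = \<Sum> a\<^sub>i \<otimes> b\<^sub>i\<close>.\<close>

definition T_map :: "('a, 'k) tensor2 \<Rightarrow> ('a \<Rightarrow> 'k) \<Rightarrow> 'a"
  where "T_map r \<phi> = lift_tensor (\<lambda>x y. \<phi> x *s y) r"

lemma tensors_eq_iff:
  "(\<Sum>(a, b)\<leftarrow>xs. a \<otimes> b) = (\<Sum>(a, b)\<leftarrow>ys. a \<otimes> b) \<longleftrightarrow>
   (\<forall>\<beta>. bilinear_map scale scale (*) \<beta> \<longrightarrow>
      (\<Sum>(a, b)\<leftarrow>xs. \<beta> a b) = (\<Sum>(a, b)\<leftarrow>ys. \<beta> a b))"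
proof -
  have "(\<Sum>(a, b)\<leftarrow>zs. a \<otimes> b) \<beta> =
      (if bilinear_map scale scale (*) \<beta> then \<Sum>(a, b)\<leftarrow>zs. \<beta> a b else 0)" for zs \<beta>
    by (induction zs) (auto simp: tensor_def)
  then show ?thesis by (auto simp: fun_eq_iff)
qed

lemma tensors3_eq_iff:
  "(\<Sum>(a, b, c)\<leftarrow>xs. a \<otimes>\<^sub>3 b \<otimes>\<^sub>3 c) = (\<Sum>(a, b, c)\<leftarrow>ys. a \<otimes>\<^sub>3 b \<otimes>\<^sub>3 c) \<longleftrightarrow>
   (\<forall>\<tau>. trilinear_form scale \<tau> \<longrightarrow>
      (\<Sum>(a, b, c)\<leftarrow>xs. \<tau> a b c) = (\<Sum>(a, b, c)\<leftarrow>ys. \<tau> a b c))"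
proof -
  have "(\<Sum>(a, b, c)\<leftarrow>zs. a \<otimes>\<^sub>3 b \<otimes>\<^sub>3 c) \<tau> =
      (if trilinear_form scale \<tau> then \<Sum>(a, b, c)\<leftarrow>zs. \<tau> a b c else 0)" for zs \<tau>
    by (induction zs) (auto simp: tensor3_def)
  then show ?thesis by (auto simp: fun_eq_iff)
qed

lemma bilinear_map_tensor: "bilinear_map scale scale tscale (\<otimes>)"
  by (rule bilinear_mapI, rule vector_space_axioms, rule vector_space_axioms, rule vector_space_tscale)
    (auto simp: tensor_def tscale_def fun_eq_iff dest: bilinear_mapD(4-7))

lemma lift_tensor_sum:
  assumes h: "bilinear_map scale scale s h"
  shows "lift_tensor h (\<Sum>(a, b)\<leftarrow>xs. a \<otimes> b) = (\<Sum>(a, b)\<leftarrow>xs. h a b)"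
  unfolding lift_tensor_def
proof (rule the_equality)
  fix w assume "\<exists>ys. (\<Sum>(a, b)\<leftarrow>xs. a \<otimes> b) = (\<Sum>(a, b)\<leftarrow>ys. a \<otimes> b) \<and> w = (\<Sum>(a, b)\<leftarrow>ys. h a b)"
  then obtain ys where eq: "(\<Sum>(a, b)\<leftarrow>xs. a \<otimes> b) = (\<Sum>(a, b)\<leftarrow>ys. a \<otimes> b)"
    and w: "w = (\<Sum>(a, b)\<leftarrow>ys. h a b)" by blast
  have vs: "vector_space s" using h by (rule bilinear_mapD)
  show "w = (\<Sum>(a, b)\<leftarrow>xs. h a b)"
  proof (rule ccontr)
    assume "w \<noteq> (\<Sum>(a, b)\<leftarrow>xs. h a b)"
    then obtain \<phi> where \<phi>: "Vector_Spaces.linear s (*) \<phi>" "\<phi> (w - (\<Sum>(a, b)\<leftarrow>xs. h a b)) \<noteq> 0"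
      using separating_functional[OF vs, of "w - (\<Sum>(a, b)\<leftarrow>xs. h a b)"] by auto
    have "bilinear_map scale scale (*) (\<lambda>a b. \<phi> (h a b))"
      using h linear_compose_left[OF _ \<phi>(1)] unfolding bilinear_map_def by blast
    then have "(\<Sum>(a, b)\<leftarrow>xs. \<phi> (h a b)) = (\<Sum>(a, b)\<leftarrow>ys. \<phi> (h a b))"
      using eq by (simp add: tensors_eq_iff)
    then have "\<phi> (\<Sum>(a, b)\<leftarrow>xs. h a b) = \<phi> w"
      unfolding w by (simp add: linear_sum_list[OF \<phi>(1)] case_prod_unfold)
    moreover have "\<phi> (u - v) = \<phi> u - \<phi> v" for u v
      by (rule linear_map_diff[OF \<phi>(1)])
    ultimately show False using \<phi>(2) by simp
  qed
qed blast

lemma lift_tensor3_sum: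
  assumes "vector_space s"
    and "\<And>y z. Vector_Spaces.linear scale s (\<lambda>x. h x y z)"
    and "\<And>x z. Vector_Spaces.linear scale s (\<lambda>y. h x y z)"
    and "\<And>x y. Vector_Spaces.linear scale s (\<lambda>z. h x y z)"
  shows "lift_tensor3 h (\<Sum>(a, b, c)\<leftarrow>xs. a \<otimes>\<^sub>3 b \<otimes>\<^sub>3 c) = (\<Sum>(a, b, c)\<leftarrow>xs. h a b c)"
  unfolding lift_tensor3_def
proof (rule the_equality)
  fix w assume "\<exists>ys. (\<Sum>(a, b, c)\<leftarrow>xs. a \<otimes>\<^sub>3 b \<otimes>\<^sub>3 c) = (\<Sum>(a, b, c)\<leftarrow>ys. a \<otimes>\<^sub>3 b \<otimes>\<^sub>3 c)
    \<and> w = (\<Sum>(a, b, c)\<leftarrow>ys. h a b c)"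
  then obtain ys where
    eq: "(\<Sum>(a, b, c)\<leftarrow>xs. a \<otimes>\<^sub>3 b \<otimes>\<^sub>3 c) = (\<Sum>(a, b, c)\<leftarrow>ys. a \<otimes>\<^sub>3 b \<otimes>\<^sub>3 c)"
    and w: "w = (\<Sum>(a, b, c)\<leftarrow>ys. h a b c)" by blast
  show "w = (\<Sum>(a, b, c)\<leftarrow>xs. h a b c)"
  proof (rule ccontr)
    assume "w \<noteq> (\<Sum>(a, b, c)\<leftarrow>xs. h a b c)"
    then obtain \<phi> where \<phi>: "Vector_Spaces.linear s (*) \<phi>" "\<phi> (w - (\<Sum>(a, b, c)\<leftarrow>xs. h a b c)) \<noteq> 0"
      using separating_functional[OF assms(1), of "w - (\<Sum>(a, b, c)\<leftarrow>xs. h a b c)"] by auto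
    have "trilinear_form scale (\<lambda>a b c. \<phi> (h a b c))"
      unfolding trilinear_form_def by (intro conjI allI linear_compose_left[OF _ \<phi>(1)] assms(2-4))
    then have "(\<Sum>(a, b, c)\<leftarrow>xs. \<phi> (h a b c)) = (\<Sum>(a, b, c)\<leftarrow>ys. \<phi> (h a b c))"
      using eq by (simp add: tensors3_eq_iff)
    then have "\<phi> (\<Sum>(a, b, c)\<leftarrow>xs. h a b c) = \<phi> w"
      unfolding w by (simp add: linear_sum_list[OF \<phi>(1)] case_prod_unfold)
    moreover have "\<phi> (u - v) = \<phi> u - \<phi> v" for u v
      by (rule linear_map_diff[OF \<phi>(1)])
    ultimately show False using \<phi>(2) by simp
  qed
qed blast

lemma tensor_map_sum:
  assumes "Vector_Spaces.linear scale scale f" "Vector_Spaces.linear scale scale g"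
  shows "tensor_map f g (\<Sum>(a, b)\<leftarrow>xs. a \<otimes> b) = (\<Sum>(a, b)\<leftarrow>xs. f a \<otimes> g b)"
  unfolding tensor_map_def
proof (rule lift_tensor_sum)
  show "bilinear_map scale scale tscale (\<lambda>x y. f x \<otimes> g y)"
    using assms unfolding Vector_Spaces.linear_iff
    by (intro bilinear_mapI vector_space_axioms vector_space_tscale)
      (simp_all add: bilinear_mapD(4-7)[OF bilinear_map_tensor])
qed

lemma flip_sum: "flip (\<Sum>(a, b)\<leftarrow>xs. a \<otimes> b) = (\<Sum>(a, b)\<leftarrow>xs. b \<otimes> a)"
  unfolding flip_def
proof (rule lift_tensor_sum)
  show "bilinear_map scale scale tscale (\<lambda>x y. y \<otimes> x)"
    using bilinear_map_tensor unfolding bilinear_map_def by auto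
qed

lemma tensor3_linear:
  "Vector_Spaces.linear scale tscale (\<lambda>x. x \<otimes>\<^sub>3 y \<otimes>\<^sub>3 z)"
  "Vector_Spaces.linear scale tscale (\<lambda>y. x \<otimes>\<^sub>3 y \<otimes>\<^sub>3 z)"
  "Vector_Spaces.linear scale tscale (\<lambda>z. x \<otimes>\<^sub>3 y \<otimes>\<^sub>3 z)"
  unfolding Vector_Spaces.linear_iff
  by (intro conjI allI vector_space_axioms vector_space_tscale;
      simp add: tensor3_def tscale_def fun_eq_iff trilinear_form_def Vector_Spaces.linear_iff)+

lemma tensor3_simps:
  "(x + y) \<otimes>\<^sub>3 z \<otimes>\<^sub>3 w = x \<otimes>\<^sub>3 z \<otimes>\<^sub>3 w + y \<otimes>\<^sub>3 z \<otimes>\<^sub>3 w"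
  "z \<otimes>\<^sub>3 (x + y) \<otimes>\<^sub>3 w = z \<otimes>\<^sub>3 x \<otimes>\<^sub>3 w + z \<otimes>\<^sub>3 y \<otimes>\<^sub>3 w"
  "z \<otimes>\<^sub>3 w \<otimes>\<^sub>3 (x + y) = z \<otimes>\<^sub>3 w \<otimes>\<^sub>3 x + z \<otimes>\<^sub>3 w \<otimes>\<^sub>3 y"
  "(c *s x) \<otimes>\<^sub>3 z \<otimes>\<^sub>3 w = tscale c (x \<otimes>\<^sub>3 z \<otimes>\<^sub>3 w)"
  "z \<otimes>\<^sub>3 (c *s x) \<otimes>\<^sub>3 w = tscale c (z \<otimes>\<^sub>3 x \<otimes>\<^sub>3 w)"
  "z \<otimes>\<^sub>3 w \<otimes>\<^sub>3 (c *s x) = tscale c (z \<otimes>\<^sub>3 w \<otimes>\<^sub>3 x)"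
proof -
  note lin = tensor3_linear[unfolded Vector_Spaces.linear_iff, THEN conjunct2, THEN conjunct2]
  show "(x + y) \<otimes>\<^sub>3 z \<otimes>\<^sub>3 w = x \<otimes>\<^sub>3 z \<otimes>\<^sub>3 w + y \<otimes>\<^sub>3 z \<otimes>\<^sub>3 w"
    by (rule lin(1)[THEN conjunct1, rule_format])
  show "z \<otimes>\<^sub>3 (x + y) \<otimes>\<^sub>3 w = z \<otimes>\<^sub>3 x \<otimes>\<^sub>3 w + z \<otimes>\<^sub>3 y \<otimes>\<^sub>3 w"
    by (rule lin(2)[THEN conjunct1, rule_format])
  show "z \<otimes>\<^sub>3 w \<otimes>\<^sub>3 (x + y) = z \<otimes>\<^sub>3 w \<otimes>\<^sub>3 x + z \<otimes>\<^sub>3 w \<otimes>\<^sub>3 y"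
    by (rule lin(3)[THEN conjunct1, rule_format])
  show "(c *s x) \<otimes>\<^sub>3 z \<otimes>\<^sub>3 w = tscale c (x \<otimes>\<^sub>3 z \<otimes>\<^sub>3 w)"
    by (rule lin(1)[THEN conjunct2, rule_format])
  show "z \<otimes>\<^sub>3 (c *s x) \<otimes>\<^sub>3 w = tscale c (z \<otimes>\<^sub>3 x \<otimes>\<^sub>3 w)"
    by (rule lin(2)[THEN conjunct2, rule_format])
  show "z \<otimes>\<^sub>3 w \<otimes>\<^sub>3 (c *s x) = tscale c (z \<otimes>\<^sub>3 w \<otimes>\<^sub>3 x)"
    by (rule lin(3)[THEN conjunct2, rule_format])
qed

lemma T_map_sum:
  assumes "\<phi> \<in> dual"
  shows "T_map (\<Sum>(a, b)\<leftarrow>xs. a \<otimes> b) \<phi> = (\<Sum>(a, b)\<leftarrow>xs. \<phi> a *s b)"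
  unfolding T_map_def
proof (rule lift_tensor_sum)
  show "bilinear_map scale scale scale (\<lambda>x y. \<phi> x *s y)"
    using assms unfolding dual_def Vector_Spaces.linear_iff
    by (intro bilinear_mapI vector_space_axioms)
      (simp_all add: scale_left_distrib scale_right_distrib mult.commute)
qed

end


section \<open>Perm algebras, coalgebras and bialgebras\<close>

locale perm_algebra = fd_space scale
  for scale :: "'k::field_char_0 \<Rightarrow> 'a::ab_group_add \<Rightarrow> 'a" (infixr "*s" 75) +
  fixes mult :: "'a \<Rightarrow> 'a \<Rightarrow> 'a" (infixl "\<cdot>" 74)
  assumes mult_bilinear: "bilinear_map scale scale scale mult"
    and perm_assoc: "a \<cdot> (b \<cdot> c) = (a \<cdot> b) \<cdot> c"
    and perm_left_comm: "(a \<cdot> b) \<cdot> c = (b \<cdot> a) \<cdot> c"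
begin

definition L :: "'a \<Rightarrow> 'a \<Rightarrow> 'a" where "L a b = a \<cdot> b"
definition R :: "'a \<Rightarrow> 'a \<Rightarrow> 'a" where "R a b = b \<cdot> a"
definition ad :: "'a \<Rightarrow> 'a \<Rightarrow> 'a" where "ad a b = L a b - R a b"

text \<open>
  The left-hand side of the perm Yang-Baxter equation, as a bilinear expression in
  \<open>r = \<Sum> a\<^sub>i \<otimes> b\<^sub>i\<close> and \<open>r = \<Sum> a\<^sub>j \<otimes> b\<^sub>j\<close>;
  lemma \<open>perm_YB_sum\<close> below expresses it as a double sum.
\<close>

definition perm_YB :: "('a, 'k) tensor2 \<Rightarrow> ('a, 'k) tensor3"
  where "perm_YB r =
    lift_tensor (\<lambda>a b. lift_tensor (\<lambda>a' b'.
        a \<otimes>\<^sub>3 b \<cdot> a' \<otimes>\<^sub>3 b' - a \<otimes>\<^sub>3 a' \<otimes>\<^sub>3 b \<cdot> b'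
      + a \<cdot> a' \<otimes>\<^sub>3 b \<otimes>\<^sub>3 b' - a' \<cdot> a \<otimes>\<^sub>3 b \<otimes>\<^sub>3 b') r) r"

text \<open>\<open>(id \<otimes> R(a) - ad(a) \<otimes> id)(r)\<close>, i.e. \<open>\<Delta>\<^sub>r(a)\<close>.\<close>

definition coboundary :: "('a, 'k) tensor2 \<Rightarrow> 'a \<Rightarrow> ('a, 'k) tensor2"
  where "coboundary r a = tensor_map id (R a) r - tensor_map (ad a) id r"

definition R_ad_invariant :: "('a, 'k) tensor2 \<Rightarrow> bool"
  where "R_ad_invariant s \<longleftrightarrow> (\<forall>a. tensor_map id (R a) s - tensor_map (ad a) id s = 0)"

definition rota_baxter_operator :: "'k \<Rightarrow> ('a \<Rightarrow> 'a) \<Rightarrow> bool"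
  where "rota_baxter_operator wt P \<longleftrightarrow> Vector_Spaces.linear scale scale P \<and>
    (\<forall>a b. P a \<cdot> P b = P (P a \<cdot> b + a \<cdot> P b + wt *s (a \<cdot> b)))"

lemma perm_YB_sum:
  assumes "r = (\<Sum>(a, b)\<leftarrow>xs. a \<otimes> b)"
  shows "perm_YB r = (\<Sum>(a, b)\<leftarrow>xs. \<Sum>(a', b')\<leftarrow>xs.
        a \<otimes>\<^sub>3 b \<cdot> a' \<otimes>\<^sub>3 b' - a \<otimes>\<^sub>3 a' \<otimes>\<^sub>3 b \<cdot> b'
      + a \<cdot> a' \<otimes>\<^sub>3 b \<otimes>\<^sub>3 b' - a' \<cdot> a \<otimes>\<^sub>3 b \<otimes>\<^sub>3 b')"
proof -
  define F where "F a b a' b' =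
        a \<otimes>\<^sub>3 b \<cdot> a' \<otimes>\<^sub>3 b' - a \<otimes>\<^sub>3 a' \<otimes>\<^sub>3 b \<cdot> b'
      + a \<cdot> a' \<otimes>\<^sub>3 b \<otimes>\<^sub>3 b' - a' \<cdot> a \<otimes>\<^sub>3 b \<otimes>\<^sub>3 b'" for a b a' b'
  have m: "(x + y) \<cdot> z = x \<cdot> z + y \<cdot> z" "z \<cdot> (x + y) = z \<cdot> x + z \<cdot> y"
    "(c *s x) \<cdot> z = c *s (x \<cdot> z)" "z \<cdot> (c *s x) = c *s (z \<cdot> x)" for x y z c
    by (rule bilinear_mapD[OF mult_bilinear])+
  interpret ts: vector_space "tscale :: 'k \<Rightarrow> ('a, 'k) tensor3 \<Rightarrow> ('a, 'k) tensor3"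
    by (rule vector_space_tscale)
  note vs = vector_space_axioms ts.vector_space_axioms
  note alg = F_def tensor3_simps m ts.scale_right_distrib ts.scale_right_diff_distrib
  have inner: "lift_tensor (F a b) r = (\<Sum>(a', b')\<leftarrow>xs. F a b a' b')" for a b
    unfolding assms
    by (rule lift_tensor_sum[where s = tscale], intro bilinear_mapI vs)
      (simp_all only: alg, simp_all only: algebra_simps)
  have sum_add: "(\<Sum>(a', b')\<leftarrow>ys. G a' b' + H a' b') = (\<Sum>(a', b')\<leftarrow>ys. G a' b') + (\<Sum>(a', b')\<leftarrow>ys. H a' b')"
    for ys and G H :: "'a \<Rightarrow> 'a \<Rightarrow> ('a, 'k) tensor3"
    by (induction ys) (simp_all only: list.map sum_list.Nil sum_list.Cons case_prod_unfold add_ac add_0_left)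
  have sum_scale: "(\<Sum>(a', b')\<leftarrow>ys. tscale c (G a' b')) = tscale c (\<Sum>(a', b')\<leftarrow>ys. G a' b')"
    for ys c and G :: "'a \<Rightarrow> 'a \<Rightarrow> ('a, 'k) tensor3"
    by (induction ys) (simp_all only: list.map sum_list.Nil sum_list.Cons case_prod_unfold
        ts.scale_right_distrib ts.scale_zero_right)
  have Fl: "F (x + y) b a' b' = F x b a' b' + F y b a' b'"
    "F b (x + y) a' b' = F b x a' b' + F b y a' b'"
    "F (c *s x) b a' b' = tscale c (F x b a' b')"
    "F b (c *s x) a' b' = tscale c (F b x a' b')" for x y b a' b' c
    by (simp_all only: alg, simp_all only: algebra_simps)
  have "perm_YB r = lift_tensor (\<lambda>a b. lift_tensor (F a b) r) r"
    unfolding perm_YB_def F_def ..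
  also have "\<dots> = lift_tensor (\<lambda>a b. \<Sum>(a', b')\<leftarrow>xs. F a b a' b') r"
    by (simp only: inner)
  also have "\<dots> = (\<Sum>(a, b)\<leftarrow>xs. \<Sum>(a', b')\<leftarrow>xs. F a b a' b')"
    unfolding assms
    by (rule lift_tensor_sum[where s = tscale], intro bilinear_mapI vs)
      (simp_all only: Fl sum_add sum_scale)
  finally show ?thesis unfolding F_def .
qed

end

locale perm_coalgebra = fd_space scale
  for scale :: "'k::field_char_0 \<Rightarrow> 'a::ab_group_add \<Rightarrow> 'a" (infixr "*s" 75) +
  fixes \<Delta> :: "'a \<Rightarrow> ('a, 'k) tensor2"
  assumes coprod_in_tensors: "\<Delta> a \<in> tensors"
    and coprod_linear: "Vector_Spaces.linear scale tscale \<Delta>"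
    and coassoc: "coprod_left \<Delta> (\<Delta> a) = coprod_right \<Delta> (\<Delta> a)"
    and left_cocomm: "coprod_right \<Delta> (\<Delta> a) = flip12 (coprod_left \<Delta> (\<Delta> a))"

locale perm_bialgebra = perm_algebra scale mult + perm_coalgebra scale \<Delta>
  for scale :: "'k::field_char_0 \<Rightarrow> 'a::ab_group_add \<Rightarrow> 'a" (infixr "*s" 75)
    and mult :: "'a \<Rightarrow> 'a \<Rightarrow> 'a" (infixl "\<cdot>" 74)
    and \<Delta> :: "'a \<Rightarrow> ('a, 'k) tensor2" +
  assumes compat1: "\<Delta> (a \<cdot> b) = tensor_map (ad a) id (\<Delta> b) + tensor_map id (R b) (\<Delta> a)"
    and compat2: "flip (tensor_map (R b) id (\<Delta> a)) = tensor_map (R a) id (\<Delta> b)"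
    and compat3: "\<Delta> (a \<cdot> b) =
      tensor_map id (L a) (\<Delta> b) + tensor_map (ad b) id (\<Delta> a - flip (\<Delta> a))"

locale quasi_triangular_perm_bialgebra = perm_bialgebra scale mult \<Delta>
  for scale :: "'k::field_char_0 \<Rightarrow> 'a::ab_group_add \<Rightarrow> 'a" (infixr "*s" 75)
    and mult :: "'a \<Rightarrow> 'a \<Rightarrow> 'a" (infixl "\<cdot>" 74)
    and \<Delta> :: "'a \<Rightarrow> ('a, 'k) tensor2" +
  fixes r :: "('a, 'k) tensor2"
  assumes r_in_tensors: "r \<in> tensors"
    and coprod_eq: "\<Delta> = coboundary r"
    and perm_YBE: "perm_YB r = 0"
    and skew_part_invariant: "R_ad_invariant (tscale (1 / 2) (r - flip r))"

locale triangular_perm_bialgebra = quasi_triangular_perm_bialgebra +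
  assumes r_symmetric: "flip r = r"


section \<open>Quadratic Rota-Baxter perm algebras\<close>

locale quadratic_perm_algebra = perm_algebra scale mult
  for scale :: "'k::field_char_0 \<Rightarrow> 'a::ab_group_add \<Rightarrow> 'a" (infixr "*s" 75)
    and mult :: "'a \<Rightarrow> 'a \<Rightarrow> 'a" (infixl "\<cdot>" 74) +
  fixes \<BB> :: "'a \<Rightarrow> 'a \<Rightarrow> 'k"
  assumes form_bilinear: "bilinear_map scale scale (*) \<BB>"
    and form_skew: "\<BB> a b = - \<BB> b a"
    and form_invariant: "\<BB> (a \<cdot> b) c = \<BB> a (b \<cdot> c - c \<cdot> b)"
    and form_nondeg_left: "(\<And>b. \<BB> a b = 0) \<Longrightarrow> a = 0"
    and form_nondeg_right: "(\<And>a. \<BB> a b = 0) \<Longrightarrow> b = 0"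

locale quadratic_rota_baxter_perm_algebra = quadratic_perm_algebra scale mult \<BB>
  for scale :: "'k::field_char_0 \<Rightarrow> 'a::ab_group_add \<Rightarrow> 'a" (infixr "*s" 75)
    and mult :: "'a \<Rightarrow> 'a \<Rightarrow> 'a" (infixl "\<cdot>" 74)
    and \<BB> :: "'a \<Rightarrow> 'a \<Rightarrow> 'k" +
  fixes P :: "'a \<Rightarrow> 'a" and wt :: 'k
  assumes rota_baxter: "rota_baxter_operator wt P"
    and form_rota_baxter: "\<BB> (P a) b + \<BB> a (P b) + wt * \<BB> a b = 0"

definition sharp :: "('a \<Rightarrow> 'a \<Rightarrow> 'k) \<Rightarrow> 'a \<Rightarrow> ('a \<Rightarrow> 'k)"
  where "sharp \<BB> a = (\<lambda>b. \<BB> a b)"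

end

(* The form B turns the coboundary of r into minus the dual of the product
     x * y = P(x) y + x P(y),
   that is <Delta_r(a), B(x,_) (x) B(y,_)> = - B(a, x * y). The Rota-Baxter identity gives
   P(x * y) = P(x) P(y), hence * is a perm product, which is the perm coalgebra axiom for Delta_r.
   The adjoints of L(a), R(a), ad(a), P under B are L(a), ad(a), R(a), -P, so every remaining
   condition becomes, when tested on forms B(x,_) (x) B(y,_) (which span all bilinear forms since B
   is nondegenerate), an identity between values of B. *)
theory Submission
  imports Defs
begin

section \<open>Tensors as functionals on multilinear forms\<close>

context fd_space
begin

text \<open>Weight 0 is what makes \<open>r\<close> symmetric: \<open>P\<close> is then skew for the
  skew form \<open>\<BB>\<close>, and the two signs cancel. The skew part of \<open>r\<close> is
  therefore zero, which settles its invariance. Tested on product forms, the Yang-Baxter expression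
  becomes the difference of \<open>\<BB> z (P (x \<star> y))\<close> and
  \<open>\<BB> z (P x \<cdot> P y)\<close>, so the equation is the Rota-Baxter identity itself. The
  encoding shapes the rest: a tensor is a functional on all functions of two or three vectors, with
  default value 0 off the multilinear ones, and the operations on it are defined through unspecified
  representing sums. Each operation is therefore traded for its effect on the test form, which
  leaves identities between scalars.\<close>

abbreviation bilinear_form :: "('a \<Rightarrow> 'a \<Rightarrow> 'k) \<Rightarrow> bool"
  where "bilinear_form \<equiv> bilinear_map scale scale (*)"

text \<open>Agreement on trilinear forms forces equality only for finite sums of pure tensors, so
  both sides of each identity in the third tensor power have to be shown to lie here.\<close>

definition tensors3 :: "('a, 'k) tensor3 set"
  where "tensors3 = {t. \<exists>xs. t = (\<Sum>(a, b, c)\<leftarrow>xs. a \<otimes>\<^sub>3 b \<otimes>\<^sub>3 c)}"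

lemma bilinear_formI:
  assumes "\<And>x y z. h (x + y) z = h x z + h y z" "\<And>x y z. h z (x + y) = h z x + h z y"
    and "\<And>c x z. h (c *s x) z = c * h x z" "\<And>c x z. h z (c *s x) = c * h z x"
  shows "bilinear_form h"
  by (intro bilinear_mapI vector_space_axioms vector_space_mult assms)

lemma trilinear_formD:
  assumes "trilinear_form scale \<tau>"
  shows "\<tau> (x + y) u v = \<tau> x u v + \<tau> y u v" "\<tau> u (x + y) v = \<tau> u x v + \<tau> u y v"
    "\<tau> u v (x + y) = \<tau> u v x + \<tau> u v y"
    "\<tau> (c *s x) u v = c * \<tau> x u v" "\<tau> u (c *s x) v = c * \<tau> u x v"
    "\<tau> u v (c *s x) = c * \<tau> u v x"
  using assms unfolding trilinear_form_def Vector_Spaces.linear_iff by blast+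

lemma trilinear_formI:
  assumes "\<And>x y u v. \<tau> (x + y) u v = \<tau> x u v + \<tau> y u v"
    "\<And>x y u v. \<tau> u (x + y) v = \<tau> u x v + \<tau> u y v"
    "\<And>x y u v. \<tau> u v (x + y) = \<tau> u v x + \<tau> u v y"
    "\<And>x c u v. \<tau> (c *s x) u v = c * \<tau> x u v"
    "\<And>x c u v. \<tau> u (c *s x) v = c * \<tau> u x v"
    "\<And>x c u v. \<tau> u v (c *s x) = c * \<tau> u v x"
  shows "trilinear_form scale \<tau>"
  unfolding trilinear_form_def Vector_Spaces.linear_iff
  by (intro conjI allI assms vector_space_axioms vector_space_mult)

lemma tensor_sum_eval:
  "(\<Sum>(a, b)\<leftarrow>xs. a \<otimes> b) \<beta> = (if bilinear_form \<beta> then \<Sum>(a, b)\<leftarrow>xs. \<beta> a b else 0)"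
  by (induction xs) (auto simp: tensor_def)

lemma tensor3_sum_eval:
  "(\<Sum>(a, b, c)\<leftarrow>xs. a \<otimes>\<^sub>3 b \<otimes>\<^sub>3 c) \<tau> =
    (if trilinear_form scale \<tau> then \<Sum>(a, b, c)\<leftarrow>xs. \<tau> a b c else 0)"
  by (induction xs) (auto simp: tensor3_def)

lemma sum_list_apply: "(\<Sum>x\<leftarrow>xs. f x) \<beta> = (\<Sum>x\<leftarrow>xs. f x \<beta>)"
  for f :: "'b \<Rightarrow> 'c \<Rightarrow> 'd::comm_monoid_add"
  by (induction xs) auto

lemma tensors_eval_nonbilinear: "t \<in> tensors \<Longrightarrow> \<not> bilinear_form \<beta> \<Longrightarrow> t \<beta> = 0"
  unfolding tensors_def by (auto simp: tensor_sum_eval)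

lemma tensors3_eval_nontrilinear: "t \<in> tensors3 \<Longrightarrow> \<not> trilinear_form scale \<tau> \<Longrightarrow> t \<tau> = 0"
  unfolding tensors3_def by (auto simp: tensor3_sum_eval)

lemma bilinear_form_add:
  "bilinear_form \<beta> \<Longrightarrow> bilinear_form \<gamma> \<Longrightarrow> bilinear_form (\<lambda>u v. \<beta> u v + \<gamma> u v)"
  by (rule bilinear_formI) (simp_all add: bilinear_mapD algebra_simps)

lemma bilinear_form_scale: "bilinear_form \<beta> \<Longrightarrow> bilinear_form (\<lambda>u v. c * \<beta> u v)"
  by (rule bilinear_formI) (simp_all add: bilinear_mapD algebra_simps)

text \<open>Bilinearity of the summands matters: two functions that are not bilinear can have a
  bilinear sum, while both evaluate to the default 0.\<close>

lemma tensors_eval_add: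
  assumes "t \<in> tensors" "bilinear_form \<beta>" "bilinear_form \<gamma>"
  shows "t (\<lambda>u v. \<beta> u v + \<gamma> u v) = t \<beta> + t \<gamma>"
proof -
  obtain xs where t: "t = (\<Sum>(a, b)\<leftarrow>xs. a \<otimes> b)" using assms(1) unfolding tensors_def by blast
  show ?thesis
    unfolding t tensor_sum_eval using assms(2,3) bilinear_form_add[OF assms(2,3)]
    by (simp add: case_prod_unfold sum_list_addf)
qed

lemma tensors_eval_scale:
  assumes "t \<in> tensors" "bilinear_form \<beta>"
  shows "t (\<lambda>u v. c * \<beta> u v) = c * t \<beta>"
proof -
  obtain xs where t: "t = (\<Sum>(a, b)\<leftarrow>xs. a \<otimes> b)" using assms(1) unfolding tensors_def by blast
  show ?thesis
    unfolding t tensor_sum_eval using assms(2) bilinear_form_scale[OF assms(2)]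
    by (simp add: case_prod_unfold sum_list_const_mult)
qed

text \<open>Addition and \<open>tscale\<close> are pointwise, so for each fixed
  \<open>\<beta>\<close> the function \<open>\<lambda>u v. h u v \<beta>\<close> is a bilinear form,
  and \<open>t\<close> can be evaluated at it.\<close>

lemma lift_tensor_eval:
  assumes "t \<in> tensors" "bilinear_map scale scale tscale h"
  shows "lift_tensor h t \<beta> = t (\<lambda>u v. h u v \<beta>)"
proof -
  obtain xs where t: "t = (\<Sum>(a, b)\<leftarrow>xs. a \<otimes> b)" using assms(1) unfolding tensors_def by blast
  have "bilinear_form (\<lambda>u v. h u v \<beta>)"
    by (rule bilinear_formI) (simp_all add: bilinear_mapD[OF assms(2)] tscale_def)
  then show ?thesis
    unfolding t lift_tensor_sum[OF assms(2)] tensor_sum_eval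
    by (simp add: sum_list_apply case_prod_unfold)
qed

text \<open>Tensors are sums without coefficients, so the lift is a plain sum of values of
  \<open>h\<close>; this is why \<open>S\<close> is asked to contain 0 and to be closed under
  addition.\<close>

lemma lift_tensor_closed:
  assumes "t \<in> tensors" "bilinear_map scale scale s h"
    and "0 \<in> S" "\<And>x y. x \<in> S \<Longrightarrow> y \<in> S \<Longrightarrow> x + y \<in> S" "\<And>u v. h u v \<in> S"
  shows "lift_tensor h t \<in> S"
proof -
  obtain xs where t: "t = (\<Sum>(a, b)\<leftarrow>xs. a \<otimes> b)" using assms(1) unfolding tensors_def by blast
  have "(\<Sum>(a, b)\<leftarrow>xs. h a b) \<in> S" by (induction xs) (auto intro: assms)
  then show ?thesis unfolding t lift_tensor_sum[OF assms(2)] .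
qed

section \<open>Closure properties of the tensor powers, and evaluation of the induced maps\<close>

lemma zero_in_tensors [simp]: "0 \<in> tensors"
  unfolding tensors_def by (force intro: exI[of _ "[]"])

lemma zero_in_tensors3 [simp]: "0 \<in> tensors3"
  unfolding tensors3_def by (force intro: exI[of _ "[]"])

lemma tensor_in_tensors [simp]: "a \<otimes> b \<in> tensors"
  unfolding tensors_def by (force intro: exI[of _ "[(a, b)]"])

lemma tensor3_in_tensors3 [simp]: "a \<otimes>\<^sub>3 b \<otimes>\<^sub>3 c \<in> tensors3"
  unfolding tensors3_def by (force intro: exI[of _ "[(a, b, c)]"])

lemma tensors_add:
  assumes "s \<in> tensors" "t \<in> tensors"
  shows "s + t \<in> tensors"
proof -
  obtain xs ys where "s = (\<Sum>(a, b)\<leftarrow>xs. a \<otimes> b)" "t = (\<Sum>(a, b)\<leftarrow>ys. a \<otimes> b)"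
    using assms unfolding tensors_def by blast
  then have "s + t = (\<Sum>(a, b)\<leftarrow>xs @ ys. a \<otimes> b)"
    by (simp only: map_append sum_list_append)
  then show ?thesis unfolding tensors_def by blast
qed

lemma tensors3_add:
  assumes "s \<in> tensors3" "t \<in> tensors3"
  shows "s + t \<in> tensors3"
proof -
  obtain xs ys where "s = (\<Sum>(a, b, c)\<leftarrow>xs. a \<otimes>\<^sub>3 b \<otimes>\<^sub>3 c)" "t = (\<Sum>(a, b, c)\<leftarrow>ys. a \<otimes>\<^sub>3 b \<otimes>\<^sub>3 c)"
    using assms unfolding tensors3_def by blast
  then have "s + t = (\<Sum>(a, b, c)\<leftarrow>xs @ ys. a \<otimes>\<^sub>3 b \<otimes>\<^sub>3 c)"
    by (simp only: map_append sum_list_append)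
  then show ?thesis unfolding tensors3_def by blast
qed

lemma tensors_scale:
  assumes "t \<in> tensors" shows "tscale c t \<in> tensors"
proof -
  obtain xs where t: "t = (\<Sum>(a, b)\<leftarrow>xs. a \<otimes> b)" using assms unfolding tensors_def by blast
  interpret ts: vector_space "tscale :: 'k \<Rightarrow> ('a, 'k) tensor2 \<Rightarrow> ('a, 'k) tensor2"
    by (rule vector_space_tscale)
  \<comment> \<open>The scalar is absorbed into the left factor of every pure tensor.\<close>
  have "tscale c t = (\<Sum>(a, b)\<leftarrow>xs. (c *s a) \<otimes> b)"
    unfolding t using linear_sum_list[OF ts.linear_scale_self]
    by (simp only: case_prod_unfold bilinear_mapD(6)[OF bilinear_map_tensor])
  also have "\<dots> = (\<Sum>(a, b)\<leftarrow>map (\<lambda>(a, b). (c *s a, b)) xs. a \<otimes> b)"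
    by (simp only: map_map o_def case_prod_unfold fst_conv snd_conv)
  finally show ?thesis unfolding tensors_def by blast
qed

lemma tensors_uminus: "t \<in> tensors \<Longrightarrow> - t \<in> tensors"
  using tensors_scale[of t "-1"] by (simp add: tscale_def fun_Compl_def)

lemma tensors_diff: "s \<in> tensors \<Longrightarrow> t \<in> tensors \<Longrightarrow> s - t \<in> tensors"
  using tensors_add[OF _ tensors_uminus, of s t] by simp

lemma tensors3_uminus:
  assumes "t \<in> tensors3" shows "- t \<in> tensors3"
proof -
  obtain xs where t: "t = (\<Sum>(a, b, c)\<leftarrow>xs. a \<otimes>\<^sub>3 b \<otimes>\<^sub>3 c)"
    using assms unfolding tensors3_def by blast
  have "- (a \<otimes>\<^sub>3 b \<otimes>\<^sub>3 c) = (- a) \<otimes>\<^sub>3 b \<otimes>\<^sub>3 c" for a b c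
    using tensor3_simps(4)[of "-1" a b c] by (simp add: tscale_def fun_eq_iff)
  then have "- t = (\<Sum>(a, b, c)\<leftarrow>map (\<lambda>(a, b, c). (- a, b, c)) xs. a \<otimes>\<^sub>3 b \<otimes>\<^sub>3 c)"
    unfolding t by (simp only: uminus_sum_list_map map_map o_def case_prod_unfold fst_conv snd_conv)
  then show ?thesis unfolding tensors3_def by blast
qed

lemma tensors3_diff: "s \<in> tensors3 \<Longrightarrow> t \<in> tensors3 \<Longrightarrow> s - t \<in> tensors3"
  using tensors3_add[OF _ tensors3_uminus, of s t] by simp

lemma tensors3_sum_list: "(\<And>x. f x \<in> tensors3) \<Longrightarrow> (\<Sum>x\<leftarrow>xs. f x) \<in> tensors3"
  by (induction xs) (simp_all only: list.map sum_list.Nil sum_list.Cons zero_in_tensors3 tensors3_add)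

lemma bilinear_map_tensor_comp:
  assumes "Vector_Spaces.linear scale scale f" "Vector_Spaces.linear scale scale g"
  shows "bilinear_map scale scale tscale (\<lambda>x y. f x \<otimes> g y)"
  using assms unfolding Vector_Spaces.linear_iff
  by (intro bilinear_mapI vector_space_axioms vector_space_tscale)
    (simp_all add: bilinear_mapD(4-7)[OF bilinear_map_tensor])

lemma bilinear_map_tensor_flip: "bilinear_map scale scale tscale (\<lambda>x y. y \<otimes> x)"
  using bilinear_map_tensor unfolding bilinear_map_def by auto

lemma tensor_map_in_tensors:
  assumes "t \<in> tensors" "Vector_Spaces.linear scale scale f" "Vector_Spaces.linear scale scale g"
  shows "tensor_map f g t \<in> tensors"
  unfolding tensor_map_def
  by (rule lift_tensor_closed[OF assms(1) bilinear_map_tensor_comp[OF assms(2,3)]])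
    (simp_all add: tensors_add)

lemma flip_in_tensors: "t \<in> tensors \<Longrightarrow> flip t \<in> tensors"
  unfolding flip_def
  by (rule lift_tensor_closed[OF _ bilinear_map_tensor_flip]) (simp_all add: tensors_add)

lemma tensor_map_eval:
  assumes "t \<in> tensors" "Vector_Spaces.linear scale scale f" "Vector_Spaces.linear scale scale g"
    and "bilinear_form \<beta>"
  shows "tensor_map f g t \<beta> = t (\<lambda>u v. \<beta> (f u) (g v))"
  unfolding tensor_map_def lift_tensor_eval[OF assms(1) bilinear_map_tensor_comp[OF assms(2,3)]]
  using assms(4) by (simp add: tensor_def)

lemma flip_eval:
  assumes "t \<in> tensors" "bilinear_form \<beta>"
  shows "flip t \<beta> = t (\<lambda>u v. \<beta> v u)"
  unfolding flip_def lift_tensor_eval[OF assms(1) bilinear_map_tensor_flip]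
  using assms(2) by (simp add: tensor_def)

lemma bilinear_map_tensor3:
  "bilinear_map scale scale tscale (\<lambda>u v. u \<otimes>\<^sub>3 v \<otimes>\<^sub>3 y)"
  "bilinear_map scale scale tscale (\<lambda>u v. y \<otimes>\<^sub>3 u \<otimes>\<^sub>3 v)"
  using tensor3_linear unfolding bilinear_map_def by auto

text \<open>If \<open>\<tau>\<close> is not trilinear, the default value turns these into the zero
  form. They are the forms on which \<open>\<Delta> x\<close> is added and scaled when the coproduct
  maps are shown to be bilinear.\<close>

lemma bilinear_form_tensor3_eval:
  "bilinear_form (\<lambda>u v. (u \<otimes>\<^sub>3 v \<otimes>\<^sub>3 y) \<tau>)"
  "bilinear_form (\<lambda>u v. (y \<otimes>\<^sub>3 u \<otimes>\<^sub>3 v) \<tau>)"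
  by (rule bilinear_formI; simp add: tensor3_simps tscale_def)+

section \<open>Iterated coproducts as functionals\<close>

context
  fixes \<Delta> :: "'a \<Rightarrow> ('a, 'k) tensor2"
  assumes \<Delta>_in: "\<And>a. \<Delta> a \<in> tensors"
    and \<Delta>_linear: "Vector_Spaces.linear scale tscale \<Delta>"
begin

lemma \<Delta>_simps: "\<Delta> (x + y) = \<Delta> x + \<Delta> y" "\<Delta> (c *s x) = tscale c (\<Delta> x)"
  using \<Delta>_linear unfolding Vector_Spaces.linear_iff by auto

text \<open>The outer lift in \<open>coprod_left\<close> is meaningful once this holds. Linearity in
  \<open>x\<close> comes from \<open>\<Delta>\<close>, linearity in \<open>y\<close> from the third
  tensor factor. The coalgebra laws stay out of the context because these facts serve to prove
  them.\<close>

lemma bilinear_map_coprod_left: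
  "bilinear_map scale scale tscale (\<lambda>x y. lift_tensor (\<lambda>u v. u \<otimes>\<^sub>3 v \<otimes>\<^sub>3 y) (\<Delta> x))"
proof -
  have eval: "lift_tensor (\<lambda>u v. u \<otimes>\<^sub>3 v \<otimes>\<^sub>3 y) (\<Delta> x) \<tau> = \<Delta> x (\<lambda>u v. (u \<otimes>\<^sub>3 v \<otimes>\<^sub>3 y) \<tau>)" for x y \<tau>
    by (rule lift_tensor_eval[OF \<Delta>_in bilinear_map_tensor3(1)])
  show ?thesis
    by (intro bilinear_mapI vector_space_axioms vector_space_tscale ext;
        simp only: plus_fun_apply tscale_def eval; simp only: \<Delta>_simps plus_fun_apply tscale_def
          tensor3_simps tensors_eval_add[OF \<Delta>_in] tensors_eval_scale[OF \<Delta>_in] bilinear_form_tensor3_eval)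
qed

lemma bilinear_map_coprod_right:
  "bilinear_map scale scale tscale (\<lambda>x y. lift_tensor (\<lambda>u v. x \<otimes>\<^sub>3 u \<otimes>\<^sub>3 v) (\<Delta> y))"
proof -
  have eval: "lift_tensor (\<lambda>u v. x \<otimes>\<^sub>3 u \<otimes>\<^sub>3 v) (\<Delta> y) \<tau> = \<Delta> y (\<lambda>u v. (x \<otimes>\<^sub>3 u \<otimes>\<^sub>3 v) \<tau>)" for x y \<tau>
    by (rule lift_tensor_eval[OF \<Delta>_in bilinear_map_tensor3(2)])
  show ?thesis
    by (intro bilinear_mapI vector_space_axioms vector_space_tscale ext;
        simp only: plus_fun_apply tscale_def eval; simp only: \<Delta>_simps plus_fun_apply tscale_def
          tensor3_simps tensors_eval_add[OF \<Delta>_in] tensors_eval_scale[OF \<Delta>_in] bilinear_form_tensor3_eval)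
qed

lemma coprod_left_in_tensors3: "t \<in> tensors \<Longrightarrow> coprod_left \<Delta> t \<in> tensors3"
  unfolding coprod_left_def
  by (intro lift_tensor_closed[OF _ bilinear_map_coprod_left]
      lift_tensor_closed[OF \<Delta>_in bilinear_map_tensor3(1)]) (simp_all add: tensors3_add)

lemma coprod_right_in_tensors3: "t \<in> tensors \<Longrightarrow> coprod_right \<Delta> t \<in> tensors3"
  unfolding coprod_right_def
  by (intro lift_tensor_closed[OF _ bilinear_map_coprod_right]
      lift_tensor_closed[OF \<Delta>_in bilinear_map_tensor3(2)]) (simp_all add: tensors3_add)

lemma coprod_left_eval:
  assumes "t \<in> tensors" "trilinear_form scale \<tau>"
  shows "coprod_left \<Delta> t \<tau> = t (\<lambda>x y. \<Delta> x (\<lambda>u v. \<tau> u v y))"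
  using assms(2) unfolding coprod_left_def lift_tensor_eval[OF assms(1) bilinear_map_coprod_left]
    lift_tensor_eval[OF \<Delta>_in bilinear_map_tensor3(1)] by (simp add: tensor3_def)

lemma coprod_right_eval:
  assumes "t \<in> tensors" "trilinear_form scale \<tau>"
  shows "coprod_right \<Delta> t \<tau> = t (\<lambda>x y. \<Delta> y (\<lambda>u v. \<tau> x u v))"
  using assms(2) unfolding coprod_right_def lift_tensor_eval[OF assms(1) bilinear_map_coprod_right]
    lift_tensor_eval[OF \<Delta>_in bilinear_map_tensor3(2)] by (simp add: tensor3_def)

end

lemma flip12_sum:
  "flip12 (\<Sum>(a, b, c)\<leftarrow>xs. a \<otimes>\<^sub>3 b \<otimes>\<^sub>3 c) = (\<Sum>(a, b, c)\<leftarrow>xs. b \<otimes>\<^sub>3 a \<otimes>\<^sub>3 c)"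
  unfolding flip12_def by (intro lift_tensor3_sum[where s = tscale] vector_space_tscale tensor3_linear)

lemma flip12_in_tensors3:
  assumes "t \<in> tensors3" shows "flip12 t \<in> tensors3"
proof -
  obtain xs where t: "t = (\<Sum>(a, b, c)\<leftarrow>xs. a \<otimes>\<^sub>3 b \<otimes>\<^sub>3 c)"
    using assms unfolding tensors3_def by blast
  have "flip12 t = (\<Sum>(a, b, c)\<leftarrow>map (\<lambda>(a, b, c). (b, a, c)) xs. a \<otimes>\<^sub>3 b \<otimes>\<^sub>3 c)"
    unfolding t flip12_sum by (simp only: map_map o_def case_prod_unfold fst_conv snd_conv)
  then show ?thesis unfolding tensors3_def by blast
qed

lemma flip12_eval:
  assumes "t \<in> tensors3" "trilinear_form scale \<tau>"
  shows "flip12 t \<tau> = t (\<lambda>x y z. \<tau> y x z)"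
proof -
  obtain xs where t: "t = (\<Sum>(a, b, c)\<leftarrow>xs. a \<otimes>\<^sub>3 b \<otimes>\<^sub>3 c)"
    using assms(1) unfolding tensors3_def by blast
  have "trilinear_form scale (\<lambda>x y z. \<tau> y x z)"
    by (rule trilinear_formI) (simp_all add: trilinear_formD[OF assms(2)])
  then show ?thesis unfolding t flip12_sum tensor3_sum_eval
    using assms(2) by (simp add: sum_list_apply tensor3_def case_prod_unfold)
qed

end

section \<open>Tensors on a quadratic perm algebra\<close>

context quadratic_perm_algebra
begin

lemmas mult_simps = bilinear_mapD(4-7)[OF mult_bilinear]
lemmas form_simps = bilinear_mapD(4-7)[OF form_bilinear]

lemma linear_mult:
  "Vector_Spaces.linear scale scale (\<lambda>x. a \<cdot> x)" "Vector_Spaces.linear scale scale (\<lambda>x. x \<cdot> a)"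
  using mult_bilinear unfolding bilinear_map_def by auto

lemma linear_form: "Vector_Spaces.linear scale (*) (\<BB> a)"
  using form_bilinear unfolding bilinear_map_def by auto

lemma linear_form_left: "Vector_Spaces.linear scale (*) (\<lambda>a. \<BB> a b)"
  using form_bilinear unfolding bilinear_map_def by auto

lemmas mult_diff = linear_map_diff[OF linear_mult(1)] linear_map_diff[OF linear_mult(2)]
lemmas form_diff = linear_map_diff[OF linear_form] linear_map_diff[OF linear_form_left]

lemma linear_R: "Vector_Spaces.linear scale scale (R a)"
  using linear_mult(2) unfolding R_def .

lemma linear_L: "Vector_Spaces.linear scale scale (L a)"
  using linear_mult(1) unfolding L_def .

lemma linear_ad: "Vector_Spaces.linear scale scale (ad a)"
  using linear_L linear_R unfolding Vector_Spaces.linear_iff ad_def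
  by (auto simp: scale_right_diff_distrib)

lemma linear_id: "Vector_Spaces.linear scale scale id"
  unfolding Vector_Spaces.linear_iff using vector_space_axioms by simp

lemma form_R_adjoint: "\<BB> (R a x) y = \<BB> x (ad a y)"
  unfolding R_def ad_def L_def by (rule form_invariant)

text \<open>Skewness of \<open>\<BB>\<close> reverses the adjunction between \<open>R a\<close> and
  \<open>ad a\<close>.\<close>

lemma form_ad_adjoint: "\<BB> (ad a x) y = \<BB> x (R a y)"
  using form_R_adjoint[of a y x] form_skew[of x "R a y"] form_skew[of "ad a x" y] by simp

text \<open>\<open>L a\<close> is the sum of \<open>ad a\<close> and \<open>R a\<close>, and taking
  adjoints exchanges the two summands.\<close>

lemma form_L_adjoint: "\<BB> (L a x) y = \<BB> x (L a y)"
  using form_R_adjoint[of a x y] form_ad_adjoint[of a x y] unfolding ad_def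
  by (simp add: form_diff)

text \<open>Commutators annihilate everything by left multiplication; this kills half of each side
  of the second compatibility condition.\<close>

lemma ad_R_mult: "R x (ad a y) = 0"
  unfolding R_def ad_def L_def by (simp add: mult_diff perm_left_comm)

lemma inj_sharp: "inj (sharp \<BB>)"
proof (rule injI)
  fix x y assume "sharp \<BB> x = sharp \<BB> y"
  then have "\<BB> (x - y) b = 0" for b unfolding sharp_def by (simp add: form_diff fun_eq_iff)
  then show "x = y" using form_nondeg_left[of "x - y"] by simp
qed

text \<open>The vectors \<open>e' k\<close> form the basis dual to \<open>E\<close> with respect to
  \<open>\<BB>\<close>; the reproducing formula is what expands multilinear forms into products of
  functionals \<open>\<BB> x\<close>.\<close>

lemma form_coordinates:
  obtains E e' where "finite E" "\<And>z. (\<Sum>k\<in>E. \<BB> (e' k) z *s k) = z"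
proof -
  obtain C where C: "finite C" "span C = UNIV" using finite_dim by blast
  obtain E where E: "E \<subseteq> C" "independent E" "C \<subseteq> span E"
    using maximal_independent_subset[of C] by blast
  have fin: "finite E" using E(1) C(1) finite_subset by blast
  have span: "span E = UNIV" using C(2) E(3) span_minimal[OF E(3) subspace_span] by auto
  interpret fin: finite_dimensional_vector_space scale E
    by unfold_locales (fact fin E(2) span)+
  \<comment> \<open>The coordinates \<open>\<BB> a k\<close> are packed into a vector of the same
    space: nondegeneracy makes this endomorphism injective, and finite dimension makes it
    surjective.\<close>
  define F where "F a = (\<Sum>k\<in>E. \<BB> a k *s k)" for a
  have lin: "Vector_Spaces.linear scale scale F"
    unfolding Vector_Spaces.linear_iff F_def using vector_space_axioms
    by (simp add: form_simps scale_left_distrib sum.distrib scale_sum_right)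
  have coord: "c k = d k" if "(\<Sum>k\<in>E. c k *s k) = (\<Sum>k\<in>E. d k *s k)" "k \<in> E" for c d k
  proof -
    have "(\<Sum>k\<in>E. (c k - d k) *s k) = 0"
      using that(1) by (simp add: scale_left_diff_distrib sum_subtractf)
    from independentD[OF E(2) fin subset_refl this that(2)] show ?thesis by simp
  qed
  have expand: "\<exists>c. z = (\<Sum>k\<in>E. c k *s k)" for z
    using span span_finite[OF fin] by auto
  have "inj F"
  proof (rule injI)
    fix x y assume "F x = F y"
    then have eq: "\<BB> x k = \<BB> y k" if "k \<in> E" for k
      using coord[of "\<BB> x" "\<BB> y"] that unfolding F_def by blast
    have "\<BB> x z = \<BB> y z" for z
    proof -
      interpret lx: Vector_Spaces.linear scale "(*)" "\<BB> x" by (rule linear_form)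
      interpret ly: Vector_Spaces.linear scale "(*)" "\<BB> y" by (rule linear_form)
      obtain c where "z = (\<Sum>k\<in>E. c k *s k)" using expand by blast
      then show ?thesis by (simp add: lx.sum ly.sum form_simps eq)
    qed
    then show "x = y" using inj_sharp unfolding sharp_def by (auto dest: injD)
  qed
  then have "surj F" using fin.linear_inj_imp_surj[OF lin] by blast
  \<comment> \<open>Since \<open>F (e' k) = k\<close>, comparing coefficients in the basis
    \<open>E\<close> yields the Kronecker delta.\<close>
  define e' where "e' = inv F"
  have dual: "\<BB> (e' k) l = (if l = k then 1 else 0)" if "k \<in> E" "l \<in> E" for k l
  proof -
    have "F (e' k) = (\<Sum>l\<in>E. (if l = k then 1 else 0) *s l)"
      using \<open>surj F\<close> that(1) fin unfolding e'_def
      by (simp add: surj_f_inv_f if_distrib[of "\<lambda>c. c *s _"] sum.delta cong: if_cong)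
    then show ?thesis
      unfolding F_def by (rule coord[of "\<BB> (e' k)" "\<lambda>l. if l = k then 1 else 0", OF _ that(2)])
  qed
  have "(\<Sum>k\<in>E. \<BB> (e' k) z *s k) = z" for z
  proof -
    obtain c where z: "z = (\<Sum>k\<in>E. c k *s k)" using expand by blast
    have "\<BB> (e' k) z = c k" if "k \<in> E" for k
    proof -
      interpret l: Vector_Spaces.linear scale "(*)" "\<BB> (e' k)" by (rule linear_form)
      show ?thesis unfolding z using that fin by (simp add: l.sum form_simps dual if_distrib cong: if_cong)
    qed
    then show ?thesis using z by simp
  qed
  with fin show ?thesis by (rule that)
qed

lemma bilinear_form_product: "bilinear_form (\<lambda>u v. \<BB> x u * \<BB> y v)"
  by (rule bilinear_formI) (simp_all add: form_simps algebra_simps)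

lemma trilinear_form_product: "trilinear_form scale (\<lambda>u v w. \<BB> x u * \<BB> y v * \<BB> z w)"
  by (rule trilinear_formI) (simp_all add: form_simps algebra_simps)

text \<open>Expanding both arguments along the dual basis writes a bilinear form as a combination of
  product forms with coefficients \<open>\<beta> k l\<close>; off the bilinear forms both tensors
  take the default value 0.\<close>

lemma tensors_eqI:
  assumes "s \<in> tensors" "t \<in> tensors"
    and eq: "\<And>x y. s (\<lambda>u v. \<BB> x u * \<BB> y v) = t (\<lambda>u v. \<BB> x u * \<BB> y v)"
  shows "s = t"
proof
  obtain E e' where E: "finite E" "\<And>z. (\<Sum>k\<in>E. \<BB> (e' k) z *s k) = z"
    using form_coordinates by blast
  fix \<beta>
  show "s \<beta> = t \<beta>"
  proof (cases "bilinear_form \<beta>")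
    case False
    then show ?thesis using assms(1,2) by (simp add: tensors_eval_nonbilinear)
  next
    case True
    have pure: "\<beta> u v = (\<Sum>k\<in>E. \<Sum>l\<in>E. \<beta> k l * (\<BB> (e' k) u * \<BB> (e' l) v))" for u v
    proof -
      interpret left: Vector_Spaces.linear scale "(*)" "\<lambda>x. \<beta> x y" for y
        using True unfolding bilinear_map_def by blast
      interpret right: Vector_Spaces.linear scale "(*)" "\<lambda>y. \<beta> x y" for x
        using True unfolding bilinear_map_def by blast
      have "\<beta> u v = \<beta> (\<Sum>k\<in>E. \<BB> (e' k) u *s k) (\<Sum>l\<in>E. \<BB> (e' l) v *s l)"
        by (simp only: E(2))
      also have "\<dots> = (\<Sum>k\<in>E. \<Sum>l\<in>E. \<beta> k l * (\<BB> (e' k) u * \<BB> (e' l) v))"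
        by (simp only: left.sum left.scale,
            simp only: right.sum right.scale sum_distrib_left mult_ac)
      finally show ?thesis .
    qed
    have expand: "t \<beta> = (\<Sum>k\<in>E. \<Sum>l\<in>E. \<beta> k l * t (\<lambda>u v. \<BB> (e' k) u * \<BB> (e' l) v))"
      if "t \<in> tensors" for t
    proof -
      obtain xs where t: "t = (\<Sum>(a, b)\<leftarrow>xs. a \<otimes> b)" using \<open>t \<in> tensors\<close> unfolding tensors_def by blast
      have "(\<Sum>(a, b)\<leftarrow>xs. \<beta> a b) =
          (\<Sum>k\<in>E. \<Sum>l\<in>E. \<beta> k l * (\<Sum>(a, b)\<leftarrow>xs. \<BB> (e' k) a * \<BB> (e' l) b))"
      proof (induction xs)
        case (Cons p xs)
        obtain a b where "p = (a, b)" by (cases p)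
        then show ?case using Cons pure[of a b] by (simp add: distrib_left sum.distrib)
      qed simp
      then show ?thesis unfolding t tensor_sum_eval by (simp add: True bilinear_form_product)
    qed
    show ?thesis by (simp only: expand[OF assms(1)] expand[OF assms(2)] eq)
  qed
qed

lemma tensors3_eqI:
  assumes "s \<in> tensors3" "t \<in> tensors3"
    and eq: "\<And>x y z. s (\<lambda>u v w. \<BB> x u * \<BB> y v * \<BB> z w) = t (\<lambda>u v w. \<BB> x u * \<BB> y v * \<BB> z w)"
  shows "s = t"
proof
  obtain E e' where E: "finite E" "\<And>z. (\<Sum>k\<in>E. \<BB> (e' k) z *s k) = z"
    using form_coordinates by blast
  fix \<tau>
  show "s \<tau> = t \<tau>"
  proof (cases "trilinear_form scale \<tau>")
    case False
    then show ?thesis using assms(1,2) by (simp add: tensors3_eval_nontrilinear)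
  next
    case True
    have pure: "\<tau> u v w = (\<Sum>k\<in>E. \<Sum>l\<in>E. \<Sum>m\<in>E. \<tau> k l m * (\<BB> (e' k) u * \<BB> (e' l) v * \<BB> (e' m) w))"
      for u v w
    proof -
      interpret first: Vector_Spaces.linear scale "(*)" "\<lambda>x. \<tau> x y z" for y z
        using True unfolding trilinear_form_def by blast
      interpret second: Vector_Spaces.linear scale "(*)" "\<lambda>y. \<tau> x y z" for x z
        using True unfolding trilinear_form_def by blast
      interpret third: Vector_Spaces.linear scale "(*)" "\<lambda>z. \<tau> x y z" for x y
        using True unfolding trilinear_form_def by blast
      have "\<tau> u v w =
          \<tau> (\<Sum>k\<in>E. \<BB> (e' k) u *s k) (\<Sum>l\<in>E. \<BB> (e' l) v *s l) (\<Sum>m\<in>E. \<BB> (e' m) w *s m)"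
        by (simp only: E(2))
      also have "\<dots> =
          (\<Sum>k\<in>E. \<Sum>l\<in>E. \<Sum>m\<in>E. \<tau> k l m * (\<BB> (e' k) u * \<BB> (e' l) v * \<BB> (e' m) w))"
        by (simp only: first.sum first.scale, simp only: second.sum second.scale,
            simp only: third.sum third.scale sum_distrib_left mult_ac)
      finally show ?thesis .
    qed
    have expand: "t \<tau> = (\<Sum>k\<in>E. \<Sum>l\<in>E. \<Sum>m\<in>E.
        \<tau> k l m * t (\<lambda>u v w. \<BB> (e' k) u * \<BB> (e' l) v * \<BB> (e' m) w))"
      if "t \<in> tensors3" for t
    proof -
      obtain xs where t: "t = (\<Sum>(a, b, c)\<leftarrow>xs. a \<otimes>\<^sub>3 b \<otimes>\<^sub>3 c)"
        using \<open>t \<in> tensors3\<close> unfolding tensors3_def by blast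
      have "(\<Sum>(a, b, c)\<leftarrow>xs. \<tau> a b c) = (\<Sum>k\<in>E. \<Sum>l\<in>E. \<Sum>m\<in>E.
          \<tau> k l m * (\<Sum>(a, b, c)\<leftarrow>xs. \<BB> (e' k) a * \<BB> (e' l) b * \<BB> (e' m) c))"
      proof (induction xs)
        case (Cons p xs)
        obtain a b c where "p = (a, b, c)" by (cases p)
        then show ?case using Cons pure[of a b c] by (simp add: distrib_left sum.distrib)
      qed simp
      then show ?thesis unfolding t tensor3_sum_eval by (simp add: True trilinear_form_product)
    qed
    show ?thesis by (simp only: expand[OF assms(1)] expand[OF assms(2)] eq)
  qed
qed

lemma coboundary_in_tensors: "r \<in> tensors \<Longrightarrow> coboundary r a \<in> tensors"
  unfolding coboundary_def by (intro tensors_diff tensor_map_in_tensors linear_id linear_R linear_ad)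

end

section \<open>The coboundary of a Rota-Baxter operator of weight zero\<close>

text \<open>Reading the condition on \<open>r\<close> at the functionals
  \<open>sharp \<BB> x\<close> replaces the inverse of \<open>sharp \<BB>\<close> by the plain value
  \<open>P x\<close>.\<close>

locale rota_baxter_tensor = quadratic_rota_baxter_perm_algebra scale mult \<BB> P 0
  for scale :: "'k::field_char_0 \<Rightarrow> 'a::ab_group_add \<Rightarrow> 'a" (infixr "*s" 75)
    and mult :: "'a \<Rightarrow> 'a \<Rightarrow> 'a" (infixl "\<cdot>" 74)
    and \<BB> :: "'a \<Rightarrow> 'a \<Rightarrow> 'k"
    and P :: "'a \<Rightarrow> 'a" +
  fixes r :: "('a, 'k) tensor2"
  assumes r_tensors: "r \<in> tensors"
    and T_map_r: "T_map r (sharp \<BB> x) = P x"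
begin

text \<open>The descendent product of a Rota-Baxter operator of weight 0.\<close>

definition star :: "'a \<Rightarrow> 'a \<Rightarrow> 'a" (infixl "\<star>" 74)
  where "x \<star> y = P x \<cdot> y + x \<cdot> P y"

lemma P_linear: "Vector_Spaces.linear scale scale P"
  using rota_baxter unfolding rota_baxter_operator_def by blast

lemma P_mult: "P x \<cdot> P y = P (x \<star> y)"
  using rota_baxter unfolding rota_baxter_operator_def star_def by simp

lemma P_skew: "\<BB> (P x) y = - \<BB> x (P y)"
  using form_rota_baxter[of x y] by (simp add: eq_neg_iff_add_eq_0)

text \<open>Both sides expand to \<open>P x \<cdot> P y \<cdot> z + P x \<cdot> y \<cdot> P z + x
  \<cdot> P y \<cdot> P z\<close>.\<close>

lemma star_assoc: "(x \<star> y) \<star> z = x \<star> (y \<star> z)"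
  \<comment> \<open>Only the outer products are unfolded, so that \<open>P (x \<star> y)\<close> is
    still visible and can be replaced by \<open>P x \<cdot> P y\<close>.\<close>
  unfolding star_def[of "x \<star> y"] star_def[of x "y \<star> z"] P_mult[symmetric]
  unfolding star_def by (simp add: mult_simps perm_assoc algebra_simps)

text \<open>In the same three-term expansion, exchanging \<open>x\<close> and \<open>y\<close>
  preserves the first term and exchanges the other two, up to commuting the two leftmost
  factors.\<close>

lemma star_left_comm: "(x \<star> y) \<star> z = (y \<star> x) \<star> z"
  unfolding star_def[of "x \<star> y"] star_def[of "y \<star> x"] P_mult[symmetric]
  unfolding star_def
  by (simp add: mult_simps perm_left_comm[of "P y" "P x"] perm_left_comm[of "P y" x]
      perm_left_comm[of y "P x"] algebra_simps)

text \<open>Contracting the first leg with \<open>\<BB> x\<close> is an application of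
  \<open>T_map r\<close>. The functional on the other leg stays general because the Yang-Baxter
  expression also feeds in functionals such as
  \<open>\<lambda>u. \<BB> y (a \<cdot> u)\<close>.\<close>

lemma r_eval_left:
  assumes "Vector_Spaces.linear scale (*) \<phi>"
  shows "r (\<lambda>u v. \<BB> x u * \<phi> v) = \<phi> (P x)"
proof -
  obtain xs where r: "r = (\<Sum>(a, b)\<leftarrow>xs. a \<otimes> b)" using r_tensors unfolding tensors_def by blast
  have \<phi>: "\<phi> (u + v) = \<phi> u + \<phi> v" "\<phi> (c *s u) = c * \<phi> u" for u v c
    using assms unfolding Vector_Spaces.linear_iff by auto
  have bil: "bilinear_form (\<lambda>u v. \<BB> x u * \<phi> v)"
    by (rule bilinear_formI) (simp_all add: form_simps \<phi> algebra_simps)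
  have "\<phi> (P x) = \<phi> (\<Sum>(a, b)\<leftarrow>xs. \<BB> x a *s b)"
    using T_map_r[of x] T_map_sum[of "sharp \<BB> x" xs] linear_form[of x]
    unfolding r dual_def sharp_def by simp
  also have "\<dots> = (\<Sum>(a, b)\<leftarrow>xs. \<BB> x a * \<phi> b)"
    by (simp only: linear_sum_list[OF assms] case_prod_unfold \<phi>)
  also have "\<dots> = r (\<lambda>u v. \<BB> x u * \<phi> v)"
    unfolding r tensor_sum_eval by (simp only: bil if_True)
  finally show ?thesis by simp
qed

lemma flip_r: "flip r = r"
proof (rule tensors_eqI[OF flip_in_tensors[OF r_tensors] r_tensors])
  fix x y
  have "flip r (\<lambda>u v. \<BB> x u * \<BB> y v) = r (\<lambda>u v. \<BB> y u * \<BB> x v)"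
    by (simp add: flip_eval r_tensors bilinear_form_product mult.commute)
  also have "\<dots> = \<BB> x (P y)" by (rule r_eval_left[OF linear_form])
  also have "\<dots> = \<BB> y (P x)" using P_skew[of x y] form_skew[of "P x" y] by simp
  also have "\<dots> = r (\<lambda>u v. \<BB> x u * \<BB> y v)" by (rule r_eval_left[OF linear_form, symmetric])
  finally show "flip r (\<lambda>u v. \<BB> x u * \<BB> y v) = r (\<lambda>u v. \<BB> x u * \<BB> y v)" .
qed

lemma r_eval_right:
  assumes "Vector_Spaces.linear scale (*) \<phi>"
  shows "r (\<lambda>u v. \<phi> u * \<BB> y v) = \<phi> (P y)"
proof -
  have \<phi>: "\<phi> (u + v) = \<phi> u + \<phi> v" "\<phi> (c *s u) = c * \<phi> u" for u v c
    using assms unfolding Vector_Spaces.linear_iff by auto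
  have bil: "bilinear_form (\<lambda>u v. \<BB> y u * \<phi> v)"
    by (rule bilinear_formI) (simp_all add: form_simps \<phi> algebra_simps)
  have "r (\<lambda>u v. \<phi> u * \<BB> y v) = flip r (\<lambda>u v. \<BB> y u * \<phi> v)"
    by (subst flip_eval[OF r_tensors bil]) (simp add: mult.commute)
  then show ?thesis by (simp add: flip_r r_eval_left[OF assms])
qed

text \<open>Each map passes to its adjoint on a test vector, so the test form remains a product and
  evaluations can be chained.\<close>

lemma tensor_map_eval_product:
  assumes "t \<in> tensors"
  shows "tensor_map (ad a) id t (\<lambda>u v. \<BB> x u * \<BB> y v) = t (\<lambda>u v. \<BB> (R a x) u * \<BB> y v)"
    and "tensor_map (R a) id t (\<lambda>u v. \<BB> x u * \<BB> y v) = t (\<lambda>u v. \<BB> (ad a x) u * \<BB> y v)"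
    and "tensor_map id (R a) t (\<lambda>u v. \<BB> x u * \<BB> y v) = t (\<lambda>u v. \<BB> x u * \<BB> (ad a y) v)"
    and "tensor_map id (L a) t (\<lambda>u v. \<BB> x u * \<BB> y v) = t (\<lambda>u v. \<BB> x u * \<BB> (L a y) v)"
  by (simp_all add: tensor_map_eval assms linear_ad linear_R linear_L linear_id bilinear_form_product
      form_R_adjoint form_ad_adjoint form_L_adjoint)

lemma flip_eval_product:
  "t \<in> tensors \<Longrightarrow> flip t (\<lambda>u v. \<BB> x u * \<BB> y v) = t (\<lambda>u v. \<BB> y u * \<BB> x v)"
  by (simp add: flip_eval bilinear_form_product mult.commute)

lemma coboundary_eval_product:
  "coboundary r a (\<lambda>u v. \<BB> x u * \<BB> y v) = - \<BB> a (x \<star> y)"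
proof -
  have "coboundary r a (\<lambda>u v. \<BB> x u * \<BB> y v) = \<BB> (ad a y) (P x) - \<BB> y (P (R a x))"
    by (simp add: coboundary_def tensor_map_eval_product r_tensors r_eval_left[OF linear_form])
  \<comment> \<open>The adjoint of \<open>ad a\<close> gives \<open>\<BB> y (P x \<cdot> a)\<close>;
    the self-adjoint \<open>L (P x)\<close> then frees \<open>a\<close>, and skewness supplies the
    sign.\<close>
  also have "\<BB> (ad a y) (P x) = - \<BB> a (P x \<cdot> y)"
    using form_ad_adjoint[of a y "P x"] form_L_adjoint[of "P x" y a] form_skew[of "P x \<cdot> y" a]
    by (simp add: R_def L_def)
  \<comment> \<open>Here the signs from \<open>P_skew\<close> and \<open>form_skew\<close>
    cancel.\<close>
  also have "\<BB> y (P (R a x)) = \<BB> a (x \<cdot> P y)"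
    using P_skew[of y "R a x"] form_skew[of "P y" "R a x"] form_L_adjoint[of x a "P y"]
    by (simp add: R_def L_def)
  finally show ?thesis by (simp add: star_def form_simps)
qed

lemma coboundary_linear: "Vector_Spaces.linear scale tscale (coboundary r)"
  unfolding Vector_Spaces.linear_iff
proof (intro conjI allI vector_space_axioms vector_space_tscale)
  show "coboundary r (a + b) = coboundary r a + coboundary r b" for a b
    by (rule tensors_eqI)
      (simp_all add: tensors_add coboundary_in_tensors r_tensors coboundary_eval_product form_simps)
  show "coboundary r (c *s a) = tscale c (coboundary r a)" for c a
  proof (rule tensors_eqI)
    show "coboundary r (c *s a) (\<lambda>u v. \<BB> x u * \<BB> y v) = tscale c (coboundary r a) (\<lambda>u v. \<BB> x u * \<BB> y v)"
      for x y
      by (simp add: tscale_def coboundary_eval_product form_simps)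
  qed (intro tensors_scale coboundary_in_tensors r_tensors)+
qed

lemmas coboundary_in = coboundary_in_tensors[OF r_tensors]

lemma coprod_left_eval_product:
  "coprod_left (coboundary r) (coboundary r a) (\<lambda>u v w. \<BB> x u * \<BB> y v * \<BB> z w)
    = - \<BB> a ((x \<star> y) \<star> z)"
proof -
  \<comment> \<open>The constant \<open>c\<close> stands for the third factor
    \<open>\<BB> z w\<close>. Skewness turns \<open>- \<BB> p (x \<star> y)\<close> into
    \<open>\<BB> (x \<star> y) p\<close>, again a test functional for the outer coproduct, so only
    the outer sign survives.\<close>
  have "coboundary r p (\<lambda>u v. \<BB> x u * \<BB> y v * c) = \<BB> (x \<star> y) p * c" for p c
    using tensors_eval_scale[OF coboundary_in[of p] bilinear_form_product, of c x y]
    by (simp add: coboundary_eval_product form_skew[of p] mult.commute)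
  then show ?thesis
    by (simp add: coprod_left_eval[OF coboundary_in coboundary_linear coboundary_in
          trilinear_form_product] coboundary_eval_product)
qed

lemma coprod_right_eval_product:
  "coprod_right (coboundary r) (coboundary r a) (\<lambda>u v w. \<BB> x u * \<BB> y v * \<BB> z w)
    = - \<BB> a (x \<star> (y \<star> z))"
proof -
  have "coboundary r p (\<lambda>u v. c * \<BB> y u * \<BB> z v) = c * \<BB> (y \<star> z) p" for p c
    using tensors_eval_scale[OF coboundary_in[of p] bilinear_form_product, of c y z]
    by (simp add: coboundary_eval_product form_skew[of p] mult.assoc)
  then show ?thesis
    by (simp add: coprod_right_eval[OF coboundary_in coboundary_linear coboundary_in
          trilinear_form_product] coboundary_eval_product)
qed

lemma perm_coalgebra_coboundary: "perm_coalgebra scale (coboundary r)"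
proof (intro perm_coalgebra.intro perm_coalgebra_axioms.intro fd_space_axioms)
  show "coboundary r a \<in> tensors" for a by (rule coboundary_in)
  show "Vector_Spaces.linear scale tscale (coboundary r)" by (rule coboundary_linear)
  note in3 = coprod_left_in_tensors3[OF coboundary_in coboundary_linear coboundary_in]
    coprod_right_in_tensors3[OF coboundary_in coboundary_linear coboundary_in]
  show "coprod_left (coboundary r) (coboundary r a) = coprod_right (coboundary r) (coboundary r a)" for a
    by (rule tensors3_eqI[OF in3])
      (simp add: coprod_left_eval_product coprod_right_eval_product star_assoc)
  show "coprod_right (coboundary r) (coboundary r a) =
      flip12 (coprod_left (coboundary r) (coboundary r a))" for a
  proof (rule tensors3_eqI[OF in3(2) flip12_in_tensors3[OF in3(1)]])
    fix x y z
    \<comment> \<open>Exchanging the first two legs exchanges \<open>x\<close> and \<open>y\<close>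
      in the test form, so the claim reduces to
      \<open>x \<star> (y \<star> z) = (y \<star> x) \<star> z\<close>.\<close>
    have "flip12 (coprod_left (coboundary r) (coboundary r a)) (\<lambda>u v w. \<BB> x u * \<BB> y v * \<BB> z w)
        = coprod_left (coboundary r) (coboundary r a) (\<lambda>u v w. \<BB> y u * \<BB> x v * \<BB> z w)"
      by (subst flip12_eval[OF in3(1) trilinear_form_product]) (simp only: mult.commute mult.left_commute)
    then show "coprod_right (coboundary r) (coboundary r a) (\<lambda>u v w. \<BB> x u * \<BB> y v * \<BB> z w)
        = flip12 (coprod_left (coboundary r) (coboundary r a)) (\<lambda>u v w. \<BB> x u * \<BB> y v * \<BB> z w)"
      by (simp only: coprod_left_eval_product coprod_right_eval_product star_assoc[symmetric]
          star_left_comm[of y x])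
  qed
qed

section \<open>The compatibility conditions as identities between values of the form\<close>

lemma form_P_mult_left: "\<BB> b (P u \<cdot> y) = - \<BB> u (P (ad b y))"
  using form_skew[of b "P u \<cdot> y"] form_invariant[of "P u" y b]
  by (simp add: P_skew ad_def L_def R_def form_diff linear_map_diff[OF P_linear])

lemma form_mult_P_right: "\<BB> b (x \<cdot> P w) = \<BB> (x \<cdot> b) (P w)"
  using form_L_adjoint[of x b "P w"] by (simp add: L_def)

text \<open>The symmetry of \<open>r\<close> in terms of \<open>P\<close>. The two preceding rules
  bring values to the shape \<open>\<BB> u (P v)\<close>, where this symmetry makes cancellations
  visible.\<close>

lemma form_P_swap: "\<BB> u (P v) = \<BB> v (P u)"
  using P_skew[of u v] form_skew[of "P u" v] by simp

text \<open>The two halves of the left side match two of the four terms on the right. The other two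
  are \<open>\<BB> (x \<cdot> a) (P (ad b y))\<close> with opposite signs.\<close>

lemma form_star_compat1:
  "\<BB> (a \<cdot> b) (x \<star> y) = \<BB> b (R a x \<star> y) + \<BB> a (x \<star> ad b y)"
proof -
  have "\<BB> (a \<cdot> b) (P x \<cdot> y) = \<BB> a (P x \<cdot> ad b y)"
    unfolding form_invariant ad_def L_def R_def mult_diff
    by (simp add: perm_assoc perm_left_comm[of b "P x"])
  moreover have "\<BB> (a \<cdot> b) (x \<cdot> P y) = \<BB> b (R a x \<cdot> P y)"
    using form_L_adjoint[of a b "x \<cdot> P y"] by (simp add: L_def R_def perm_assoc perm_left_comm[of a x])
  ultimately show ?thesis
    by (simp add: star_def form_simps form_P_mult_left[of b "x \<cdot> a"] form_mult_P_right[of a x "ad b y"]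
        R_def)
qed

text \<open>The terms \<open>ad b y \<cdot> P x\<close> and \<open>ad a x \<cdot> P y\<close>
  vanish. What remains on either side is \<open>- \<BB> (ad b y) (P (ad a x))\<close>, up to
  \<open>form_P_swap\<close>.\<close>

lemma form_star_compat2: "\<BB> a (ad b y \<star> x) = \<BB> b (ad a x \<star> y)"
  using ad_R_mult[of "P x" b y] ad_R_mult[of "P y" a x]
  by (simp add: R_def star_def form_simps form_P_mult_left form_P_swap[of "ad b y"])

text \<open>The reversed product \<open>y \<star> R b x\<close> is the contribution of
  \<open>flip\<close>. Of the six terms on the right, three reproduce the left side and three
  cancel.\<close>

lemma form_star_compat3:
  "\<BB> (a \<cdot> b) (x \<star> y) = \<BB> b (x \<star> L a y) + (\<BB> a (R b x \<star> y) - \<BB> a (y \<star> R b x))"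
proof -
  have "\<BB> (a \<cdot> b) (P x \<cdot> y) = \<BB> b (P x \<cdot> L a y)"
    using form_L_adjoint[of a b "P x \<cdot> y"] by (simp add: L_def perm_assoc perm_left_comm[of a "P x"])
  moreover have "\<BB> (a \<cdot> b) (x \<cdot> P y) = \<BB> a (R b x \<cdot> P y - P y \<cdot> R b x)"
    unfolding form_invariant R_def by (simp add: perm_assoc perm_left_comm[of b x] perm_left_comm[of "P y" x])
  \<comment> \<open>All three become \<open>\<BB> (x \<cdot> b) (P v)\<close>, with \<open>v\<close>
    equal to \<open>a \<cdot> y\<close>, \<open>- ad a y\<close> and \<open>- (y \<cdot> a)\<close>;
    these vectors add up to 0.\<close>
  moreover have "\<BB> b (x \<cdot> P (L a y)) + \<BB> a (P (R b x) \<cdot> y) - \<BB> a (y \<cdot> P (R b x)) = 0"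
    unfolding form_P_mult_left form_mult_P_right form_P_swap[of "y \<cdot> a"] ad_def L_def R_def
    by (simp add: linear_map_diff[OF P_linear] form_diff)
  ultimately show ?thesis by (simp add: star_def form_simps form_diff algebra_simps)
qed

lemma perm_bialgebra_coboundary: "perm_bialgebra scale mult (coboundary r)"
proof -
  interpret coalg: perm_coalgebra scale "coboundary r" by (rule perm_coalgebra_coboundary)
  note mem = coboundary_in tensors_add tensors_diff flip_in_tensors tensor_map_in_tensors
    linear_ad linear_R linear_L linear_id
  show ?thesis
  proof unfold_locales
    fix a b
    show "coboundary r (a \<cdot> b) =
        tensor_map (ad a) id (coboundary r b) + tensor_map id (R b) (coboundary r a)"
      by (rule tensors_eqI)
        (simp_all add: mem tensor_map_eval_product coboundary_eval_product form_star_compat1)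
    show "flip (tensor_map (R b) id (coboundary r a)) = tensor_map (R a) id (coboundary r b)"
      by (rule tensors_eqI) (simp_all add: mem flip_eval_product tensor_map_eval_product
          coboundary_eval_product form_star_compat2[of a b])
    show "coboundary r (a \<cdot> b) = tensor_map id (L a) (coboundary r b)
        + tensor_map (ad b) id (coboundary r a - flip (coboundary r a))"
      by (rule tensors_eqI) (simp_all add: mem flip_eval_product tensor_map_eval_product
          coboundary_eval_product form_star_compat3)
  qed
qed

lemma perm_YB_r: "perm_YB r = 0"
proof -
  obtain xs where r: "r = (\<Sum>(a, b)\<leftarrow>xs. a \<otimes> b)" using r_tensors unfolding tensors_def by blast
  \<comment> \<open>The evaluation rules for \<open>r\<close> are restated for its representing
    list, because \<open>perm_YB_sum\<close> gives the expression as a double sum over that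
    list.\<close>
  have left: "(\<Sum>p\<leftarrow>xs. \<BB> x (fst p) * \<phi> (snd p)) = \<phi> (P x)"
    and right: "(\<Sum>p\<leftarrow>xs. \<phi> (fst p) * \<BB> x (snd p)) = \<phi> (P x)"
    if \<phi>: "Vector_Spaces.linear scale (*) \<phi>" for \<phi> x
  proof -
    have "\<phi> (u + v) = \<phi> u + \<phi> v" "\<phi> (c *s u) = c * \<phi> u" for u v c
      using \<phi> unfolding Vector_Spaces.linear_iff by auto
    then have "bilinear_form (\<lambda>u v. \<BB> x u * \<phi> v)" "bilinear_form (\<lambda>u v. \<phi> u * \<BB> x v)"
      by (intro bilinear_formI; simp add: form_simps algebra_simps)+
    then show "(\<Sum>p\<leftarrow>xs. \<BB> x (fst p) * \<phi> (snd p)) = \<phi> (P x)"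
      "(\<Sum>p\<leftarrow>xs. \<phi> (fst p) * \<BB> x (snd p)) = \<phi> (P x)"
      using r_eval_left[OF \<phi>, of x] r_eval_right[OF \<phi>, of x]
      unfolding r tensor_sum_eval by (simp_all add: case_prod_unfold)
  qed
  have lin: "Vector_Spaces.linear scale (*) (\<lambda>u. \<BB> x (a \<cdot> u))"
    "Vector_Spaces.linear scale (*) (\<lambda>u. \<BB> x (u \<cdot> a))" for x a
    by (rule linear_compose_left[OF linear_mult(1) linear_form]
        linear_compose_left[OF linear_mult(2) linear_form])+
  note sums = left[OF lin(1)] left[OF lin(2)] right[OF lin(1)] right[OF lin(2)]
  show ?thesis
  proof (rule tensors3_eqI)
    show "perm_YB r \<in> tensors3"
      unfolding perm_YB_sum[OF r] case_prod_unfold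
      by (intro tensors3_sum_list tensors3_add tensors3_diff tensor3_in_tensors3)
    show "0 \<in> tensors3" by simp
    fix x y z
    \<comment> \<open>With the first copy \<open>(a, b)\<close> of \<open>r\<close> held fixed, each
      summand has one leg of the second copy under a bare \<open>\<BB> y\<close> or
      \<open>\<BB> z\<close>; its test vector becomes the argument of \<open>P\<close>.\<close>
    have inner: "(\<Sum>q\<leftarrow>xs. \<BB> x a * \<BB> y (b \<cdot> fst q) * \<BB> z (snd q)
          - \<BB> x a * \<BB> y (fst q) * \<BB> z (b \<cdot> snd q)
          + \<BB> x (a \<cdot> fst q) * \<BB> y b * \<BB> z (snd q) - \<BB> x (fst q \<cdot> a) * \<BB> y b * \<BB> z (snd q))
        = \<BB> x a * \<BB> y (b \<cdot> P z) - \<BB> x a * \<BB> z (b \<cdot> P y)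
          + \<BB> x (a \<cdot> P z) * \<BB> y b - \<BB> x (P z \<cdot> a) * \<BB> y b" for a b
    proof -
      have "(\<Sum>q\<leftarrow>xs. \<BB> x a * \<BB> y (b \<cdot> fst q) * \<BB> z (snd q)) = \<BB> x a * \<BB> y (b \<cdot> P z)"
        "(\<Sum>q\<leftarrow>xs. \<BB> x a * \<BB> y (fst q) * \<BB> z (b \<cdot> snd q)) = \<BB> x a * \<BB> z (b \<cdot> P y)"
        by (simp_all only: mult.assoc sum_list_const_mult sums)
      moreover have "(\<Sum>q\<leftarrow>xs. \<BB> x (a \<cdot> fst q) * \<BB> y b * \<BB> z (snd q)) = \<BB> x (a \<cdot> P z) * \<BB> y b"
        "(\<Sum>q\<leftarrow>xs. \<BB> x (fst q \<cdot> a) * \<BB> y b * \<BB> z (snd q)) = \<BB> x (P z \<cdot> a) * \<BB> y b"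
        by (simp_all only: mult.assoc mult.commute[of "\<BB> y b"], simp_all only: mult.assoc[symmetric]
            sum_list_mult_const sums)
      ultimately show ?thesis by (simp only: sum_list_addf sum_list_subtractf)
    qed
    have "perm_YB r (\<lambda>u v w. \<BB> x u * \<BB> y v * \<BB> z w)
        = (\<Sum>p\<leftarrow>xs. \<Sum>q\<leftarrow>xs. \<BB> x (fst p) * \<BB> y (snd p \<cdot> fst q) * \<BB> z (snd q)
          - \<BB> x (fst p) * \<BB> y (fst q) * \<BB> z (snd p \<cdot> snd q)
          + \<BB> x (fst p \<cdot> fst q) * \<BB> y (snd p) * \<BB> z (snd q)
          - \<BB> x (fst q \<cdot> fst p) * \<BB> y (snd p) * \<BB> z (snd q))"
      unfolding perm_YB_sum[OF r]
      by (simp add: sum_list_apply case_prod_unfold tensor3_def trilinear_form_product)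
    also have "\<dots> = \<BB> y (P x \<cdot> P z) - \<BB> z (P x \<cdot> P y) + \<BB> x (P y \<cdot> P z) - \<BB> x (P z \<cdot> P y)"
      by (simp only: inner, simp only: sum_list_addf sum_list_subtractf sums)
    also have "\<dots> = 0"
    proof -
      have "\<BB> y (P x \<cdot> P z) = \<BB> z (P (P x \<cdot> y))"
        using form_mult_P_right[of y "P x" z] form_P_swap[of "P x \<cdot> y" z] by simp
      \<comment> \<open>Invariance merges the last two terms of the sum into
        \<open>\<BB> (x \<cdot> P y) (P z)\<close>, and \<open>form_P_swap\<close> brings
        \<open>z\<close> to the front.\<close>
      moreover have "\<BB> x (P y \<cdot> P z) = \<BB> z (P (x \<cdot> P y)) + \<BB> x (P z \<cdot> P y)"
        using form_invariant[of x "P y" "P z"] form_P_swap[of "x \<cdot> P y" z]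
        by (simp add: form_diff diff_eq_eq)
      moreover have "P (P x \<cdot> y) + P (x \<cdot> P y) = P x \<cdot> P y"
        using P_linear unfolding P_mult star_def Vector_Spaces.linear_iff by simp
      then have "\<BB> z (P x \<cdot> P y) = \<BB> z (P (P x \<cdot> y)) + \<BB> z (P (x \<cdot> P y))"
        by (simp flip: form_simps(2))
      ultimately show ?thesis by simp
    qed
    finally show "perm_YB r (\<lambda>u v w. \<BB> x u * \<BB> y v * \<BB> z w) = 0 (\<lambda>u v w. \<BB> x u * \<BB> y v * \<BB> z w)"
      by simp
  qed
qed

lemma triangular_coboundary: "triangular_perm_bialgebra scale mult (coboundary r) r"
proof -
  interpret bialg: perm_bialgebra scale mult "coboundary r" by (rule perm_bialgebra_coboundary)
  \<comment> \<open>The skew part of the symmetric \<open>r\<close> is the zero tensor, that is, the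
    empty sum.\<close>
  have zero: "tensor_map f g 0 = 0"
    if "Vector_Spaces.linear scale scale f" "Vector_Spaces.linear scale scale g" for f g
    using tensor_map_sum[OF that, of "[]"] by simp
  have "R_ad_invariant (tscale (1 / 2) (r - flip r))"
    unfolding R_ad_invariant_def flip_r
    by (simp add: tscale_def zero_fun_def[symmetric] zero linear_id linear_R linear_ad)
  then show ?thesis
    by unfold_locales (simp_all add: r_tensors perm_YB_r flip_r)
qed

end

theorem proposition5p5:
  fixes scale :: "'k::field_char_0 \<Rightarrow> 'a::ab_group_add \<Rightarrow> 'a"
    and mult :: "'a \<Rightarrow> 'a \<Rightarrow> 'a"
    and \<BB> :: "'a \<Rightarrow> 'a \<Rightarrow> 'k"
    and P :: "'a \<Rightarrow> 'a"
    and r :: "('a, 'k) tensor2"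
  assumes "quadratic_rota_baxter_perm_algebra scale mult \<BB> P 0"
    and "r \<in> fd_space.tensors scale"
    and "\<And>\<phi>. \<phi> \<in> fd_space.dual scale \<Longrightarrow> fd_space.T_map scale r \<phi> = P (inv (sharp \<BB>) \<phi>)"
  shows "triangular_perm_bialgebra scale mult (perm_algebra.coboundary scale mult r) r"
proof -
  interpret quadratic_rota_baxter_perm_algebra scale mult \<BB> P 0 by fact
  have "sharp \<BB> x \<in> dual" for x
    unfolding dual_def sharp_def using linear_form by simp
  \<comment> \<open>Here \<open>inv\<close> is taken among all functions, but at
    \<open>sharp \<BB> x\<close> injectivity identifies its value as \<open>x\<close>.\<close>
  then have "T_map r (sharp \<BB> x) = P x" for x
    using assms(3) inv_f_f[OF inj_sharp] by simp
  then interpret rota_baxter_tensor scale mult \<BB> P r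
    using assms(2) by unfold_locales
  show ?thesis by (rule triangular_coboundary)
qed

end
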